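(* Let $X,Y,Z$ be Riesz spaces connected by a bilinear product, with $Z$ Dedekind complete and weakly $\sigma$-distributive, $X$ and $Y$ equipped with order convergence, and $X$ first countable with respect to order convergence. Let $(\Omega,\mathcal H)$ be a measurable space and $\mu:\mathcal H\to Y^+$ a $\sigma$-additive regular integrator. If $f:\Omega\to X$ is Pavlakos integrable on $\Omega$, then $f$ is $S^*$-partition integrable on $\Omega$ and the two integrals agree: $$\int_\Omega^{P}f\,d\mu=\int_\Omega^{S^*}f\,d\mu .$$
   Context: Riesz spaces are real and Archimedean. In a Riesz space, $(x_i)$ order converges to $x$ if there is a net $y_d\downarrow0$ such that for every $d$ there is $i^*$ with $|x_i-x|\le y_d$ for $i\ge i^*$; $(o)$-$\lim$ denotes the order limit. $(y_j)_{j\in J}$ is a quasi-subnet of $(x_i)_{i\in I}$ if for every $i_0$ there is $j_0$ with $\{y_j:j\ge j_0\}\subseteq\{x_i:i\ge i_0\}$. $X$ is first countable for order convergence ("of countable type") if every net order converging to $x$ is a quasi-subnet of a net order converging to $x$ whose tail filter has a countable base. The bilinear product $\bullet:X\times Y\to Z$ (juxtaposition) is bilinear, continuous (preserving convergent nets) in each argument separately, isotone on $X^+\times Y^+$, with $\sup_n(x_n\bullet y)=(\sup_nx_n)\bullet y$ and $\sup_n(x\bullet y_n)=x\bullet(\sup_ny_n)$ for $x\in X^+$, $y\in Y^+$ and nonnegative sequences whose suprema exist. $Z$ carries order convergence or $(D)$-convergence as specified. A $(D)$-sequence is a double sequence $\{a_{ij}\}$ with $a_{ij}\ge a_{i,j+1}$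 and $\bigwedge_ja_{ij}=0$ for all $i$ (and $(D)$-sequences are bounded, so that the suprema below exist). $Z$ is weakly $\sigma$-distributive if $\bigwedge_{\varphi\in\mathbb N^{\mathbb N}}\bigvee_ia_{i\varphi(i)}=0$ for every $(D)$-sequence. A family is unconditionally summable if the net of its finite sums (indexed by finite index subsets, ordered by inclusion) converges. $\mu$ is $\sigma$-additive if $\mu(\bigcup_nA_n)$ is the unconditional sum, in order convergence of $Y$, of $\{\mu(A_n)\}$ for disjoint $A_n\in\mathcal H$ ($\mathcal H$ a $\sigma$-algebra). $\mu$ is a regular integrator if, for the underlying net Riemann integral given by fixed nets of finite tagged families, $\int_A\mathbf 1_\Omega\,d\mu=\mu(A)=\int_\Omega\mathbf 1_A\,d\mu$ for each $A\in\mathcal H$; here for each $A$ a net $\{(\sigma_\gamma,\tau_\gamma)\}_{\gamma\in\Gamma(A)}$ of finite families $\sigma_\gamma$ in $\mathcal H$ and $\tau_\gamma$ in $\Omega$, indexed by the same set $I_\gamma$, is fixed and $\int_Ag\,d\mu=\lim_\gamma\sum_{i\in I_\gamma}g(\tau_{\gamma_i})\mu(\sigma_{\gamma_i})$. Pavlakos integral. $E(\Omega,X)$ is the set of $\mathcal H$-elementary functions $f=\sum_{n=1}^\infty a_n\mathbf 1_{A_n}$ with $a_n\in X$ and $A_n\in\mathcal H$ disjoint. A nonnegative $f\in E(\Omega,X)$ is Pavlakos integrable if $\int_\Omega^Pf\,d\mu:=(o)\text{-}\lim_n\sum_{i=1}^na_i\mu(A_i)$ exists in $Z$ (it is independent of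 the representation); a general $f\in E(\Omega,X)$ is integrable if $f^+,f^-$ are, with $\int_\Omega^Pf=\int_\Omega^Pf^+-\int_\Omega^Pf^-$. A sequence $f_n$ converges to $f$ uniformly almost everywhere in order if there are $N\in\mathcal H$ with $\mu(N)=0$ and a non-increasing $u_n\downarrow0$ in $X$ with $|f_n(\omega)-f(\omega)|\le u_n$ for $\omega\in\Omega\setminus N$ and all $n$. $M(\Omega,X)$ is the set of functions that are such limits of sequences in $E(\Omega,X)$. $f\in M(\Omega,X)$ is Pavlakos integrable on $\Omega$ if there is an increasing sequence $\{f_n\}$ of Pavlakos integrable functions in $E(\Omega,X)$ converging to $f$ uniformly almost everywhere in order; then $\int_\Omega^Pf\,d\mu=(o)\text{-}\lim_n\int_\Omega^Pf_n\,d\mu$ (this limit exists and is independent of the sequence). $S^*$-partition integral on $\Omega$: let $\mathcal P(\Omega)$ be the set of countable partitions of $\Omega$ into nonempty sets of $\mathcal H$, ordered by refinement. A choice function $\delta$ selects $\delta_\alpha\in\alpha$ for every nonempty $\alpha\subseteq\Omega$. $f:\Omega\to X$ is $S^*$-partition integrable with integral $z=\int_\Omega^{S^*}f\,d\mu\in Z$ if there is $P_*$ such that for all $P\ge P_*$ and all $\delta$ the series $\sum_{\alpha\in P}f(\delta_\alpha)\mu(\alpha)$ is unconditionally convergent (in order) in $Z$, and there is a $(D)$-sequence $\{a_{ij}\}$ in $Z$ such that for every $\varphi\in\mathbb N^{\mathbb N}$ there is $P_0$ with $|\sum_{\alpha\in P}f(\delta_\alpha)\mu(\alpha)-z|\le\bigvee_ia_{i\varphi(i)}$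 for all $P\ge P_0$ and all $\delta$. *)

theory Defs
  imports
    "HOL-Analysis.Analysis"
    "HOL-Library.Lattice_Algebras"
    "HOL-Library.Lub_Glb"
begin

section \<open>Archimedean Riesz spaces\<close>

class riesz_space = ordered_real_vector + lattice_ab_group_add_abs +
  assumes archimedean: "0 \<le> x \<Longrightarrow> (\<And>n::nat. real n *\<^sub>R x \<le> y) \<Longrightarrow> x = 0"

text \<open>Dedekind completeness is the library class \<^class>\<open>conditionally_complete_lattice\<close>,
  so a Dedekind complete Riesz space is a type of sort
  \<open>{riesz_space, conditionally_complete_lattice}\<close>.\<close>


section \<open>Nets and order convergence\<close>

text \<open>A net is given by a nonempty carrier \<open>I\<close>, a directed preorder \<open>le\<close> on it, and a function.\<close>

definition directed_index :: "'i set \<Rightarrow> ('i \<Rightarrow> 'i \<Rightarrow> bool) \<Rightarrow> bool" where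
  "directed_index I le \<longleftrightarrow> I \<noteq> {} \<and> (\<forall>i\<in>I. le i i) \<and>
     (\<forall>i\<in>I. \<forall>j\<in>I. \<forall>k\<in>I. le i j \<longrightarrow> le j k \<longrightarrow> le i k) \<and>
     (\<forall>i\<in>I. \<forall>j\<in>I. \<exists>k\<in>I. le i k \<and> le j k)"

text \<open>A net decreasing to 0 enters the definition of order convergence only through its range,
  which is a downward directed set with infimum 0; conversely every such set is a net decreasing
  to 0, indexed by itself. See \<open>order_convI\<close> below.\<close>

definition order_conv ::
    "'i set \<Rightarrow> ('i \<Rightarrow> 'i \<Rightarrow> bool) \<Rightarrow> ('i \<Rightarrow> 'a::riesz_space) \<Rightarrow> 'a \<Rightarrow> bool" where
  "order_conv I le x l \<longleftrightarrow>
     (\<exists>D. D \<noteq> {} \<and> (\<forall>a\<in>D. \<forall>b\<in>D. \<exists>c\<in>D. c \<le> a \<and> c \<le> b) \<and> isGlb UNIV D 0 \<and>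
       (\<forall>d\<in>D. \<exists>i0\<in>I. \<forall>i\<in>I. le i0 i \<longrightarrow> \<bar>x i - l\<bar> \<le> d))"

abbreviation order_conv_seq :: "(nat \<Rightarrow> 'a::riesz_space) \<Rightarrow> 'a \<Rightarrow> bool" where
  "order_conv_seq \<equiv> order_conv UNIV (\<le>)"

definition unconditional_sum :: "('k \<Rightarrow> 'a::riesz_space) \<Rightarrow> 'k set \<Rightarrow> 'a \<Rightarrow> bool" where
  "unconditional_sum g A s \<longleftrightarrow> order_conv {F. finite F \<and> F \<subseteq> A} (\<subseteq>) (sum g) s"

definition net_tail :: "'i set \<Rightarrow> ('i \<Rightarrow> 'i \<Rightarrow> bool) \<Rightarrow> ('i \<Rightarrow> 'a) \<Rightarrow> 'i \<Rightarrow> 'a set" where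
  "net_tail I le x i0 = {x i | i. i \<in> I \<and> le i0 i}"

definition quasi_subnet ::
    "'j set \<Rightarrow> ('j \<Rightarrow> 'j \<Rightarrow> bool) \<Rightarrow> ('j \<Rightarrow> 'a) \<Rightarrow> 'i set \<Rightarrow> ('i \<Rightarrow> 'i \<Rightarrow> bool) \<Rightarrow> ('i \<Rightarrow> 'a) \<Rightarrow> bool" where
  "quasi_subnet J leJ y I leI x \<longleftrightarrow>
     (\<forall>i0\<in>I. \<exists>j0\<in>J. net_tail J leJ y j0 \<subseteq> net_tail I leI x i0)"

definition tail_filter :: "'i set \<Rightarrow> ('i \<Rightarrow> 'i \<Rightarrow> bool) \<Rightarrow> ('i \<Rightarrow> 'a) \<Rightarrow> 'a set set" where
  "tail_filter I le x = {S. \<exists>i0\<in>I. net_tail I le x i0 \<subseteq> S}"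

definition has_countable_base :: "'a set set \<Rightarrow> bool" where
  "has_countable_base \<F> \<longleftrightarrow> (\<exists>\<B>\<subseteq>\<F>. countable \<B> \<and> (\<forall>S\<in>\<F>. \<exists>B\<in>\<B>. B \<subseteq> S))"

text \<open>HOL cannot quantify over the index types of nets inside a definition. Below, nets in \<open>'x\<close>
  are indexed by subsets of \<open>'x set \<times> 'x\<close>. By \<open>canonical_net\<close> every net in \<open>'x\<close> has the same
  tail filter as one indexed in this way, so nothing is lost
  (\<open>first_countable_order_any_index\<close>, \<open>preserves_order_conv_any_index\<close>).\<close>

definition first_countable_order :: "'x::riesz_space itself \<Rightarrow> bool" where
  "first_countable_order _ \<longleftrightarrow>
     (\<forall>(J :: ('x set \<times> 'x) set) leJ y l. directed_index J leJ \<longrightarrow> order_conv J leJ y (l::'x) \<longrightarrow>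
        (\<exists>(I :: ('x set \<times> 'x) set) leI x. directed_index I leI \<and> order_conv I leI x l \<and>
           has_countable_base (tail_filter I leI x) \<and> quasi_subnet J leJ y I leI x))"

definition preserves_order_conv :: "('x::riesz_space \<Rightarrow> 'z::riesz_space) \<Rightarrow> bool" where
  "preserves_order_conv h \<longleftrightarrow>
     (\<forall>(I :: ('x set \<times> 'x) set) le u l. directed_index I le \<longrightarrow> order_conv I le u l \<longrightarrow>
        order_conv I le (\<lambda>i. h (u i)) (h l))"

lemma order_convI:
  fixes x :: "'i \<Rightarrow> 'a::riesz_space" and y :: "'d \<Rightarrow> 'a"
  assumes "directed_index D leD"
    and "\<And>d e. d \<in> D \<Longrightarrow> e \<in> D \<Longrightarrow> leD d e \<Longrightarrow> y e \<le> y d"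
    and "isGlb UNIV (y ` D) 0"
    and "\<And>d. d \<in> D \<Longrightarrow> \<exists>i0\<in>I. \<forall>i\<in>I. le i0 i \<longrightarrow> \<bar>x i - l\<bar> \<le> y d"
  shows "order_conv I le x l"
  unfolding order_conv_def
proof (intro exI[of _ "y ` D"] conjI)
  show "y ` D \<noteq> {}" using assms(1) by (auto simp: directed_index_def)
  show "\<forall>a\<in>y ` D. \<forall>b\<in>y ` D. \<exists>c\<in>y ` D. c \<le> a \<and> c \<le> b"
  proof (intro ballI)
    fix a b assume "a \<in> y ` D" "b \<in> y ` D"
    then obtain d e where de: "d \<in> D" "e \<in> D" "a = y d" "b = y e" by blast
    then obtain k where "k \<in> D" "leD d k" "leD e k"
      using assms(1) unfolding directed_index_def by blast
    then show "\<exists>c\<in>y ` D. c \<le> a \<and> c \<le> b" using de assms(2) by blast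
  qed
qed (use assms(3,4) in auto)

lemma canonical_net:
  fixes x :: "'i \<Rightarrow> 'x"
  assumes "directed_index I le"
  obtains J :: "('x set \<times> 'x) set" and leJ and y :: "'x set \<times> 'x \<Rightarrow> 'x"
  where "directed_index J leJ" "quasi_subnet J leJ y I le x" "quasi_subnet I le x J leJ y"
    "tail_filter J leJ y = tail_filter I le x"
proof -
  define J where "J = {(net_tail I le x i, u) | i u. i \<in> I \<and> u \<in> net_tail I le x i}"
  define leJ :: "'x set \<times> 'x \<Rightarrow> 'x set \<times> 'x \<Rightarrow> bool" where "leJ = (\<lambda>p q. fst q \<subseteq> fst p)"
  have I0: "I \<noteq> {}" and refl: "\<And>i. i \<in> I \<Longrightarrow> le i i"
    and trans: "\<And>i j k. i \<in> I \<Longrightarrow> j \<in> I \<Longrightarrow> k \<in> I \<Longrightarrow> le i j \<Longrightarrow> le j k \<Longrightarrow> le i k"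
    and up: "\<And>i j. i \<in> I \<Longrightarrow> j \<in> I \<Longrightarrow> \<exists>k\<in>I. le i k \<and> le j k"
    using assms[unfolded directed_index_def] by blast+
  have ne: "x i \<in> net_tail I le x i" if "i \<in> I" for i
    using refl that unfolding net_tail_def by blast
  have mono: "net_tail I le x k \<subseteq> net_tail I le x i" if "i \<in> I" "k \<in> I" "le i k" for i k
    using trans[OF that(1,2) _ that(3)] unfolding net_tail_def by blast
  have tl: "net_tail J leJ snd (net_tail I le x i, u) = net_tail I le x i" if "i \<in> I" for i u
  proof (intro set_eqI iffI)
    fix v assume "v \<in> net_tail J leJ snd (net_tail I le x i, u)"
    then obtain q where "q \<in> J" "fst q \<subseteq> net_tail I le x i" "v = snd q"
      unfolding net_tail_def[of J] leJ_def by auto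
    then show "v \<in> net_tail I le x i" unfolding J_def by auto
  next
    fix v assume v: "v \<in> net_tail I le x i"
    then have "(net_tail I le x i, v) \<in> J" using that unfolding J_def by blast
    moreover have "leJ (net_tail I le x i, u) (net_tail I le x i, v)" unfolding leJ_def by simp
    ultimately show "v \<in> net_tail J leJ snd (net_tail I le x i, u)"
      unfolding net_tail_def[of J] by force
  qed
  have 0: "directed_index J leJ"
    unfolding directed_index_def
  proof (intro conjI ballI impI)
    show "J \<noteq> {}" using I0 ne unfolding J_def by blast
  next
    fix p q assume "p \<in> J" "q \<in> J"
    then obtain i j where ij: "i \<in> I" "j \<in> I" "fst p = net_tail I le x i" "fst q = net_tail I le x j"
      unfolding J_def by auto
    then obtain k where k: "k \<in> I" "le i k" "le j k" using up by blast
    then have "(net_tail I le x k, x k) \<in> J" using ne unfolding J_def by blast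
    moreover have "leJ p (net_tail I le x k, x k)" "leJ q (net_tail I le x k, x k)"
      using ij k mono[of i k] mono[of j k] unfolding leJ_def by simp_all
    ultimately show "\<exists>r\<in>J. leJ p r \<and> leJ q r" by blast
  qed (auto simp: leJ_def)
  have 1: "quasi_subnet J leJ snd I le x"
    unfolding quasi_subnet_def
  proof
    fix i assume i: "i \<in> I"
    then have "(net_tail I le x i, x i) \<in> J" using ne unfolding J_def by blast
    then show "\<exists>j0\<in>J. net_tail J leJ snd j0 \<subseteq> net_tail I le x i" using tl[OF i] by blast
  qed
  have 2: "quasi_subnet I le x J leJ snd"
    unfolding quasi_subnet_def
  proof
    fix p assume "p \<in> J"
    then obtain i u where "i \<in> I" "p = (net_tail I le x i, u)" unfolding J_def by blast
    then show "\<exists>i0\<in>I. net_tail I le x i0 \<subseteq> net_tail J leJ snd p" using tl by blast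
  qed
  have 3: "tail_filter J leJ snd = tail_filter I le x"
  proof (intro set_eqI iffI)
    fix S assume "S \<in> tail_filter J leJ snd"
    then show "S \<in> tail_filter I le x"
      using 2 unfolding tail_filter_def quasi_subnet_def by (blast intro: subset_trans)
  next
    fix S assume "S \<in> tail_filter I le x"
    then show "S \<in> tail_filter J leJ snd"
      using 1 unfolding tail_filter_def quasi_subnet_def by (blast intro: subset_trans)
  qed
  show thesis by (rule that[OF 0 1 2 3])
qed

lemma order_conv_quasi_subnet:
  assumes "quasi_subnet J leJ y I le x" "order_conv I le (\<lambda>i. g (x i)) l"
  shows "order_conv J leJ (\<lambda>j. g (y j)) l"
proof -
  from assms(2)[unfolded order_conv_def]
  obtain D where D: "D \<noteq> {} \<and> (\<forall>a\<in>D. \<forall>b\<in>D. \<exists>c\<in>D. c \<le> a \<and> c \<le> b) \<and> isGlb UNIV D 0 \<and>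
      (\<forall>d\<in>D. \<exists>i0\<in>I. \<forall>i\<in>I. le i0 i \<longrightarrow> \<bar>g (x i) - l\<bar> \<le> d)" ..
  from D have D': "\<forall>d\<in>D. \<exists>i0\<in>I. \<forall>i\<in>I. le i0 i \<longrightarrow> \<bar>g (x i) - l\<bar> \<le> d"
    by (elim conjE)
  have "\<exists>j0\<in>J. \<forall>j\<in>J. leJ j0 j \<longrightarrow> \<bar>g (y j) - l\<bar> \<le> d" if d: "d \<in> D" for d
  proof -
    obtain i0 where i0: "i0 \<in> I" "\<forall>i\<in>I. le i0 i \<longrightarrow> \<bar>g (x i) - l\<bar> \<le> d"
      using bspec[OF D' d] by (rule bexE)
    obtain j0 where j0: "j0 \<in> J" "net_tail J leJ y j0 \<subseteq> net_tail I le x i0"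
      using assms(1) i0(1) unfolding quasi_subnet_def by blast
    have "\<bar>g (y j) - l\<bar> \<le> d" if "j \<in> J" "leJ j0 j" for j
    proof -
      have "y j \<in> net_tail I le x i0" using j0(2) that unfolding net_tail_def by blast
      then show ?thesis using i0(2) unfolding net_tail_def by auto
    qed
    then show ?thesis using j0(1) by blast
  qed
  with D show ?thesis unfolding order_conv_def by (intro exI[of _ D] conjI ballI) simp_all
qed

lemma first_countable_order_any_index:
  fixes y :: "'j \<Rightarrow> 'x::riesz_space"
  assumes "first_countable_order TYPE('x)" "directed_index J leJ" "order_conv J leJ y l"
  shows "\<exists>(I :: ('x set \<times> 'x) set) leI x. directed_index I leI \<and> order_conv I leI x l \<and>
           has_countable_base (tail_filter I leI x) \<and> quasi_subnet J leJ y I leI x"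
proof -
  obtain K :: "('x set \<times> 'x) set" and leK and k
    where K: "directed_index K leK" "quasi_subnet K leK k J leJ y" "quasi_subnet J leJ y K leK k"
    by (rule canonical_net[OF assms(2), of y])
  have "order_conv K leK k l" using order_conv_quasi_subnet[OF K(2), of "\<lambda>u. u"] assms(3) by simp
  then obtain I :: "('x set \<times> 'x) set" and leI x where
    I: "directed_index I leI" "order_conv I leI x l" "has_countable_base (tail_filter I leI x)"
       "quasi_subnet K leK k I leI x"
    using assms(1) K(1) unfolding first_countable_order_def by metis
  have "quasi_subnet J leJ y I leI x"
    unfolding quasi_subnet_def
  proof
    fix i0 assume "i0 \<in> I"
    then obtain k0 where k0: "k0 \<in> K" "net_tail K leK k k0 \<subseteq> net_tail I leI x i0"
      using I(4) unfolding quasi_subnet_def by blast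
    then obtain j0 where "j0 \<in> J" "net_tail J leJ y j0 \<subseteq> net_tail K leK k k0"
      using K(3) unfolding quasi_subnet_def by blast
    then show "\<exists>j0\<in>J. net_tail J leJ y j0 \<subseteq> net_tail I leI x i0"
      using k0(2) by blast
  qed
  then show ?thesis using I by blast
qed

lemma preserves_order_conv_any_index:
  fixes u :: "'i \<Rightarrow> 'x::riesz_space" and h :: "'x \<Rightarrow> 'z::riesz_space"
  assumes "preserves_order_conv h" "directed_index I le" "order_conv I le u l"
  shows "order_conv I le (\<lambda>i. h (u i)) (h l)"
proof -
  obtain K :: "('x set \<times> 'x) set" and leK and k
    where K: "directed_index K leK" "quasi_subnet K leK k I le u" "quasi_subnet I le u K leK k"
    by (rule canonical_net[OF assms(2), of u])
  have "order_conv K leK k l" using order_conv_quasi_subnet[OF K(2), of "\<lambda>u. u"] assms(3) by simp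
  then have "order_conv K leK (\<lambda>i. h (k i)) (h l)"
    using assms(1) K(1) unfolding preserves_order_conv_def by blast
  then show ?thesis by (rule order_conv_quasi_subnet[OF K(3)])
qed


section \<open>(D)-sequences\<close>

text \<open>Boundedness ensures that every \<^const>\<open>Inf\<close> and \<^const>\<open>Sup\<close> below is that of a nonempty
  bounded set.\<close>

definition D_sequence ::
    "(nat \<Rightarrow> nat \<Rightarrow> 'z::{riesz_space, conditionally_complete_lattice}) \<Rightarrow> bool" where
  "D_sequence a \<longleftrightarrow> (\<exists>b. \<forall>i j. \<bar>a i j\<bar> \<le> b) \<and> (\<forall>i j. a i (Suc j) \<le> a i j) \<and>
     (\<forall>i. (INF j. a i j) = 0)"

definition weakly_sigma_distributive ::
    "'z::{riesz_space, conditionally_complete_lattice} itself \<Rightarrow> bool" where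
  "weakly_sigma_distributive _ \<longleftrightarrow>
     (\<forall>a :: nat \<Rightarrow> nat \<Rightarrow> 'z. D_sequence a \<longrightarrow> (INF \<phi>::nat \<Rightarrow> nat. SUP i. a i (\<phi> i)) = 0)"

definition D_conv :: "'i set \<Rightarrow> ('i \<Rightarrow> 'i \<Rightarrow> bool) \<Rightarrow>
    ('i \<Rightarrow> 'z::{riesz_space, conditionally_complete_lattice}) \<Rightarrow> 'z \<Rightarrow> bool" where
  "D_conv I le x l \<longleftrightarrow> (\<exists>a. D_sequence a \<and>
     (\<forall>\<phi>::nat \<Rightarrow> nat. \<exists>i0\<in>I. \<forall>i\<in>I. le i0 i \<longrightarrow> \<bar>x i - l\<bar> \<le> (SUP i. a i (\<phi> i))))"

text \<open>In particular, a map into \<open>'z\<close> that turns order convergent nets into (D)-convergent ones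
  satisfies \<^const>\<open>preserves_order_conv\<close>; the latter is the weaker requirement.\<close>

lemma D_conv_imp_order_conv:
  fixes x :: "'i \<Rightarrow> 'z::{riesz_space, conditionally_complete_lattice}"
  assumes "weakly_sigma_distributive TYPE('z)" "D_conv I le x l"
  shows "order_conv I le x l"
proof -
  obtain a where a: "D_sequence a"
    "\<forall>\<phi>::nat \<Rightarrow> nat. \<exists>i0\<in>I. \<forall>i\<in>I. le i0 i \<longrightarrow> \<bar>x i - l\<bar> \<le> (SUP i. a i (\<phi> i))"
    using assms(2) unfolding D_conv_def by (elim exE conjE)
  obtain b where b: "\<bar>a i j\<bar> \<le> b" for i j using a(1) unfolding D_sequence_def by blast
  have bU: "a i j \<le> b" and bL: "- b \<le> a i j" for i j
    using b[of i j] unfolding abs_lattice by (simp_all add: minus_le_iff)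
  have bdd: "bdd_above (range (\<lambda>i. a i (\<phi> i)))" for \<phi>
    using bU by (intro bdd_aboveI[of _ b]) blast
  have anti: "a i k \<le> a i j" if "j \<le> k" for i j k
    using lift_Suc_antimono_le[of "a i"] a(1) that unfolding D_sequence_def by blast
  define S :: "(nat \<Rightarrow> nat) \<Rightarrow> 'z" where "S = (\<lambda>\<phi>. SUP i. a i (\<phi> i))"
  have Smono: "S \<psi> \<le> S \<phi>" if "\<And>i. \<phi> i \<le> \<psi> i" for \<phi> \<psi>
    unfolding S_def
  proof (rule cSUP_mono)
    show "bdd_above (range (\<lambda>i. a i (\<phi> i)))" by (rule bdd)
    show "\<exists>m\<in>UNIV. a n (\<psi> n) \<le> a m (\<phi> m)" for n
      using anti[OF that[of n]] by blast
  qed simp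
  have inf0: "(INF \<phi>. S \<phi>) = 0"
    using assms(1) a(1) unfolding weakly_sigma_distributive_def S_def by blast
  have bddS: "bdd_below (range S)"
  proof (rule bdd_belowI)
    fix s assume "s \<in> range S"
    then obtain \<phi> where s: "s = S \<phi>" by blast
    show "- b \<le> s" unfolding s S_def
      by (rule order_trans[OF bL[of 0 "\<phi> 0"]]) (rule cSUP_upper[OF _ bdd], simp)
  qed
  have glb: "isGlb UNIV (range S) 0"
  proof (rule isGlbI1)
    show "greatestP (isLb UNIV (range S)) 0"
      unfolding greatestP_def isLb_def setge_def setle_def
      using cINF_lower[OF bddS] cINF_greatest[of UNIV _ S] inf0 by auto
  qed
  show ?thesis
  proof (rule order_convI[where D = UNIV and leD = "\<lambda>\<phi> \<psi>. \<forall>i. \<phi> i \<le> \<psi> i" and y = S])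
    show "directed_index UNIV (\<lambda>\<phi> \<psi>::nat \<Rightarrow> nat. \<forall>i. \<phi> i \<le> \<psi> i)"
      unfolding directed_index_def
    proof (intro conjI ballI impI)
      fix \<phi> \<psi> :: "nat \<Rightarrow> nat"
      show "\<exists>\<theta>\<in>UNIV. (\<forall>i. \<phi> i \<le> \<theta> i) \<and> (\<forall>i. \<psi> i \<le> \<theta> i)"
        by (rule bexI[of _ "\<lambda>i. max (\<phi> i) (\<psi> i)"]) auto
    qed (auto intro: order_trans)
  qed (use Smono glb a(2) in \<open>auto simp: S_def\<close>)
qed


section \<open>The bilinear product and the measure\<close>

definition riesz_product ::
    "('x::riesz_space \<Rightarrow> 'y::riesz_space \<Rightarrow> 'z::riesz_space) \<Rightarrow> bool" where
  "riesz_product bp \<longleftrightarrow>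
     bilinear bp \<and>
     (\<forall>y. preserves_order_conv (\<lambda>x. bp x y)) \<and>
     (\<forall>x. preserves_order_conv (bp x)) \<and>
     (\<forall>x x' y y'. 0 \<le> x \<longrightarrow> x \<le> x' \<longrightarrow> 0 \<le> y \<longrightarrow> y \<le> y' \<longrightarrow> bp x y \<le> bp x' y') \<and>
     (\<forall>(x :: nat \<Rightarrow> 'x) s y. (\<forall>n. 0 \<le> x n) \<longrightarrow> 0 \<le> y \<longrightarrow> isLub UNIV (range x) s \<longrightarrow>
        isLub UNIV (range (\<lambda>n. bp (x n) y)) (bp s y)) \<and>
     (\<forall>x (y :: nat \<Rightarrow> 'y) s. 0 \<le> x \<longrightarrow> (\<forall>n. 0 \<le> y n) \<longrightarrow> isLub UNIV (range y) s \<longrightarrow>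
        isLub UNIV (range (\<lambda>n. bp x (y n))) (bp x s))"

definition sigma_additive :: "'w set set \<Rightarrow> ('w set \<Rightarrow> 'y::riesz_space) \<Rightarrow> bool" where
  "sigma_additive H \<mu> \<longleftrightarrow>
     (\<forall>A :: nat \<Rightarrow> 'w set. range A \<subseteq> H \<longrightarrow> disjoint_family A \<longrightarrow>
        unconditional_sum (\<lambda>n. \<mu> (A n)) UNIV (\<mu> (\<Union>n. A n)))"

text \<open>For each \<open>A \<in> H\<close> the data \<open>\<Gamma> A\<close>, \<open>le A\<close> are the index set of the net attached to \<open>A\<close>, and
  \<open>Ix A \<gamma>\<close>, \<open>\<sigma> A \<gamma>\<close>, \<open>\<tau> A \<gamma>\<close> are the finite tagged family at stage \<open>\<gamma>\<close>.\<close>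

definition tagged_nets ::
    "'w set \<Rightarrow> 'w set set \<Rightarrow> ('w set \<Rightarrow> 'g set) \<Rightarrow> ('w set \<Rightarrow> 'g \<Rightarrow> 'g \<Rightarrow> bool) \<Rightarrow>
     ('w set \<Rightarrow> 'g \<Rightarrow> 'i set) \<Rightarrow> ('w set \<Rightarrow> 'g \<Rightarrow> 'i \<Rightarrow> 'w set) \<Rightarrow>
     ('w set \<Rightarrow> 'g \<Rightarrow> 'i \<Rightarrow> 'w) \<Rightarrow> bool" where
  "tagged_nets \<Omega> H \<Gamma> le Ix \<sigma> \<tau> \<longleftrightarrow>
     (\<forall>A\<in>H. directed_index (\<Gamma> A) (le A) \<and>
        (\<forall>\<gamma>\<in>\<Gamma> A. finite (Ix A \<gamma>) \<and> (\<forall>i\<in>Ix A \<gamma>. \<sigma> A \<gamma> i \<in> H \<and> \<tau> A \<gamma> i \<in> \<Omega>)))"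

text \<open>The net Riemann integral over \<open>A\<close> of a real-valued \<open>g\<close>; the sums live in \<open>'y\<close>.\<close>

definition net_riemann_has_integral ::
    "('w set \<Rightarrow> 'g set) \<Rightarrow> ('w set \<Rightarrow> 'g \<Rightarrow> 'g \<Rightarrow> bool) \<Rightarrow>
     ('w set \<Rightarrow> 'g \<Rightarrow> 'i set) \<Rightarrow> ('w set \<Rightarrow> 'g \<Rightarrow> 'i \<Rightarrow> 'w set) \<Rightarrow> ('w set \<Rightarrow> 'g \<Rightarrow> 'i \<Rightarrow> 'w) \<Rightarrow>
     ('w set \<Rightarrow> 'y::riesz_space) \<Rightarrow> 'w set \<Rightarrow> ('w \<Rightarrow> real) \<Rightarrow> 'y \<Rightarrow> bool" where
  "net_riemann_has_integral \<Gamma> le Ix \<sigma> \<tau> \<mu> A g v \<longleftrightarrow>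
     order_conv (\<Gamma> A) (le A) (\<lambda>\<gamma>. \<Sum>i\<in>Ix A \<gamma>. g (\<tau> A \<gamma> i) *\<^sub>R \<mu> (\<sigma> A \<gamma> i)) v"

definition regular_integrator ::
    "'w set \<Rightarrow> 'w set set \<Rightarrow> ('w set \<Rightarrow> 'g set) \<Rightarrow> ('w set \<Rightarrow> 'g \<Rightarrow> 'g \<Rightarrow> bool) \<Rightarrow>
     ('w set \<Rightarrow> 'g \<Rightarrow> 'i set) \<Rightarrow> ('w set \<Rightarrow> 'g \<Rightarrow> 'i \<Rightarrow> 'w set) \<Rightarrow> ('w set \<Rightarrow> 'g \<Rightarrow> 'i \<Rightarrow> 'w) \<Rightarrow>
     ('w set \<Rightarrow> 'y::riesz_space) \<Rightarrow> bool" where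
  "regular_integrator \<Omega> H \<Gamma> le Ix \<sigma> \<tau> \<mu> \<longleftrightarrow>
     (\<forall>A\<in>H. net_riemann_has_integral \<Gamma> le Ix \<sigma> \<tau> \<mu> A (indicator \<Omega>) (\<mu> A) \<and>
            net_riemann_has_integral \<Gamma> le Ix \<sigma> \<tau> \<mu> \<Omega> (indicator A) (\<mu> A))"


section \<open>The Pavlakos integral\<close>

text \<open>Functions on \<open>\<Omega>\<close> are total functions of which only the values on \<open>\<Omega>\<close> are used. Since the
  \<open>A n\<close> are disjoint, the sum of the \<open>a n\<close> times the indicators has at most one nonzero term
  at each point.\<close>

definition elementary_rep ::
    "'w set \<Rightarrow> 'w set set \<Rightarrow> ('w \<Rightarrow> 'x::riesz_space) \<Rightarrow> (nat \<Rightarrow> 'x) \<Rightarrow> (nat \<Rightarrow> 'w set) \<Rightarrow> bool" where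
  "elementary_rep \<Omega> H f a A \<longleftrightarrow> range A \<subseteq> H \<and> disjoint_family A \<and>
     (\<forall>n. \<forall>w\<in>A n. f w = a n) \<and> (\<forall>w\<in>\<Omega> - (\<Union>n. A n). f w = 0)"

definition elementary :: "'w set \<Rightarrow> 'w set set \<Rightarrow> ('w \<Rightarrow> 'x::riesz_space) \<Rightarrow> bool" where
  "elementary \<Omega> H f \<longleftrightarrow> (\<exists>a A. elementary_rep \<Omega> H f a A)"

definition elementary_pos_has_integral ::
    "('x::riesz_space \<Rightarrow> 'y::riesz_space \<Rightarrow> 'z::riesz_space) \<Rightarrow> 'w set \<Rightarrow> 'w set set \<Rightarrow>
     ('w set \<Rightarrow> 'y) \<Rightarrow> ('w \<Rightarrow> 'x) \<Rightarrow> 'z \<Rightarrow> bool" where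
  "elementary_pos_has_integral bp \<Omega> H \<mu> f z \<longleftrightarrow> (\<forall>w\<in>\<Omega>. 0 \<le> f w) \<and>
     (\<exists>a A. elementary_rep \<Omega> H f a A \<and> order_conv_seq (\<lambda>n. \<Sum>i<n. bp (a i) (\<mu> (A i))) z)"

definition elementary_has_integral ::
    "('x::riesz_space \<Rightarrow> 'y::riesz_space \<Rightarrow> 'z::riesz_space) \<Rightarrow> 'w set \<Rightarrow> 'w set set \<Rightarrow>
     ('w set \<Rightarrow> 'y) \<Rightarrow> ('w \<Rightarrow> 'x) \<Rightarrow> 'z \<Rightarrow> bool" where
  "elementary_has_integral bp \<Omega> H \<mu> f z \<longleftrightarrow> elementary \<Omega> H f \<and>
     (\<exists>p q. elementary_pos_has_integral bp \<Omega> H \<mu> (\<lambda>w. sup (f w) 0) p \<and>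
            elementary_pos_has_integral bp \<Omega> H \<mu> (\<lambda>w. sup (- f w) 0) q \<and> z = p - q)"

definition elementary_integrable ::
    "('x::riesz_space \<Rightarrow> 'y::riesz_space \<Rightarrow> 'z::riesz_space) \<Rightarrow> 'w set \<Rightarrow> 'w set set \<Rightarrow>
     ('w set \<Rightarrow> 'y) \<Rightarrow> ('w \<Rightarrow> 'x) \<Rightarrow> bool" where
  "elementary_integrable bp \<Omega> H \<mu> f \<longleftrightarrow> (\<exists>z. elementary_has_integral bp \<Omega> H \<mu> f z)"

definition uniform_ae_order_conv ::
    "'w set \<Rightarrow> 'w set set \<Rightarrow> ('w set \<Rightarrow> 'y::riesz_space) \<Rightarrow> (nat \<Rightarrow> 'w \<Rightarrow> 'x::riesz_space) \<Rightarrow>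
     ('w \<Rightarrow> 'x) \<Rightarrow> bool" where
  "uniform_ae_order_conv \<Omega> H \<mu> fs f \<longleftrightarrow>
     (\<exists>N\<in>H. \<mu> N = 0 \<and>
        (\<exists>u. decseq u \<and> isGlb UNIV (range u) 0 \<and> (\<forall>w\<in>\<Omega> - N. \<forall>n. \<bar>fs n w - f w\<bar> \<le> u n)))"

definition order_measurable ::
    "'w set \<Rightarrow> 'w set set \<Rightarrow> ('w set \<Rightarrow> 'y::riesz_space) \<Rightarrow> ('w \<Rightarrow> 'x::riesz_space) \<Rightarrow> bool" where
  "order_measurable \<Omega> H \<mu> f \<longleftrightarrow>
     (\<exists>fs. (\<forall>n. elementary \<Omega> H (fs n)) \<and> uniform_ae_order_conv \<Omega> H \<mu> fs f)"

definition pavlakos_approx ::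
    "('x::riesz_space \<Rightarrow> 'y::riesz_space \<Rightarrow> 'z::riesz_space) \<Rightarrow> 'w set \<Rightarrow> 'w set set \<Rightarrow>
     ('w set \<Rightarrow> 'y) \<Rightarrow> ('w \<Rightarrow> 'x) \<Rightarrow> (nat \<Rightarrow> 'w \<Rightarrow> 'x) \<Rightarrow> bool" where
  "pavlakos_approx bp \<Omega> H \<mu> f fs \<longleftrightarrow> (\<forall>n. elementary_integrable bp \<Omega> H \<mu> (fs n)) \<and>
     (\<forall>n. \<forall>w\<in>\<Omega>. fs n w \<le> fs (Suc n) w) \<and> uniform_ae_order_conv \<Omega> H \<mu> fs f"

definition pavlakos_integrable ::
    "('x::riesz_space \<Rightarrow> 'y::riesz_space \<Rightarrow> 'z::riesz_space) \<Rightarrow> 'w set \<Rightarrow> 'w set set \<Rightarrow>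
     ('w set \<Rightarrow> 'y) \<Rightarrow> ('w \<Rightarrow> 'x) \<Rightarrow> bool" where
  "pavlakos_integrable bp \<Omega> H \<mu> f \<longleftrightarrow>
     order_measurable \<Omega> H \<mu> f \<and> (\<exists>fs. pavlakos_approx bp \<Omega> H \<mu> f fs)"

definition pavlakos_has_integral ::
    "('x::riesz_space \<Rightarrow> 'y::riesz_space \<Rightarrow> 'z::riesz_space) \<Rightarrow> 'w set \<Rightarrow> 'w set set \<Rightarrow>
     ('w set \<Rightarrow> 'y) \<Rightarrow> ('w \<Rightarrow> 'x) \<Rightarrow> 'z \<Rightarrow> bool" where
  "pavlakos_has_integral bp \<Omega> H \<mu> f z \<longleftrightarrow> order_measurable \<Omega> H \<mu> f \<and>
     (\<exists>fs zs. pavlakos_approx bp \<Omega> H \<mu> f fs \<and>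
        (\<forall>n. elementary_has_integral bp \<Omega> H \<mu> (fs n) (zs n)) \<and> order_conv_seq zs z)"

definition pavlakos_integral ::
    "('x::riesz_space \<Rightarrow> 'y::riesz_space \<Rightarrow> 'z::riesz_space) \<Rightarrow> 'w set \<Rightarrow> 'w set set \<Rightarrow>
     ('w set \<Rightarrow> 'y) \<Rightarrow> ('w \<Rightarrow> 'x) \<Rightarrow> 'z" where
  "pavlakos_integral bp \<Omega> H \<mu> f = (THE z. pavlakos_has_integral bp \<Omega> H \<mu> f z)"


section \<open>The \<open>S\<^sup>*\<close>-partition integral\<close>

definition countable_partitions :: "'w set \<Rightarrow> 'w set set \<Rightarrow> 'w set set set" where
  "countable_partitions \<Omega> H = {P. partition_on \<Omega> P \<and> countable P \<and> P \<subseteq> H}"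

definition choice_function :: "'w set \<Rightarrow> ('w set \<Rightarrow> 'w) \<Rightarrow> bool" where
  "choice_function \<Omega> \<delta> \<longleftrightarrow> (\<forall>\<alpha>\<subseteq>\<Omega>. \<alpha> \<noteq> {} \<longrightarrow> \<delta> \<alpha> \<in> \<alpha>)"

text \<open>\<open>refines \<Omega> P Q\<close> says that \<open>P\<close> is the finer partition.\<close>

definition S_star_has_integral ::
    "('x::riesz_space \<Rightarrow> 'y::riesz_space \<Rightarrow> 'z::{riesz_space, conditionally_complete_lattice}) \<Rightarrow>
     'w set \<Rightarrow> 'w set set \<Rightarrow> ('w set \<Rightarrow> 'y) \<Rightarrow> ('w \<Rightarrow> 'x) \<Rightarrow> 'z \<Rightarrow> bool" where
  "S_star_has_integral bp \<Omega> H \<mu> f z \<longleftrightarrow>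
     (\<exists>P1\<in>countable_partitions \<Omega> H.
        \<forall>P\<in>countable_partitions \<Omega> H. refines \<Omega> P P1 \<longrightarrow> (\<forall>\<delta>. choice_function \<Omega> \<delta> \<longrightarrow>
          (\<exists>s. unconditional_sum (\<lambda>\<alpha>. bp (f (\<delta> \<alpha>)) (\<mu> \<alpha>)) P s))) \<and>
     (\<exists>a. D_sequence a \<and>
        (\<forall>\<phi>::nat \<Rightarrow> nat. \<exists>P0\<in>countable_partitions \<Omega> H.
           \<forall>P\<in>countable_partitions \<Omega> H. refines \<Omega> P P0 \<longrightarrow> (\<forall>\<delta>. choice_function \<Omega> \<delta> \<longrightarrow>
             (\<exists>s. unconditional_sum (\<lambda>\<alpha>. bp (f (\<delta> \<alpha>)) (\<mu> \<alpha>)) P s \<and>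
                  \<bar>s - z\<bar> \<le> (SUP i. a i (\<phi> i))))))"

definition S_star_integrable ::
    "('x::riesz_space \<Rightarrow> 'y::riesz_space \<Rightarrow> 'z::{riesz_space, conditionally_complete_lattice}) \<Rightarrow>
     'w set \<Rightarrow> 'w set set \<Rightarrow> ('w set \<Rightarrow> 'y) \<Rightarrow> ('w \<Rightarrow> 'x) \<Rightarrow> bool" where
  "S_star_integrable bp \<Omega> H \<mu> f \<longleftrightarrow> (\<exists>z. S_star_has_integral bp \<Omega> H \<mu> f z)"

definition S_star_integral ::
    "('x::riesz_space \<Rightarrow> 'y::riesz_space \<Rightarrow> 'z::{riesz_space, conditionally_complete_lattice}) \<Rightarrow>
     'w set \<Rightarrow> 'w set set \<Rightarrow> ('w set \<Rightarrow> 'y) \<Rightarrow> ('w \<Rightarrow> 'x) \<Rightarrow> 'z" where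
  "S_star_integral bp \<Omega> H \<mu> f = (THE z. S_star_has_integral bp \<Omega> H \<mu> f z)"

end

theory Submission
  imports Defs
begin

text \<open>Let \<open>f\<^sub>n\<close> be elementary functions with integrals \<open>z\<^sub>n\<close> and \<open>\<bar>f\<^sub>n - f\<bar> \<le> u\<^sub>n\<close> off a null set \<open>N\<close>,
  where \<open>u\<^sub>n\<close> decreases to 0. The proof compares the partition sums of \<open>f\<close> with \<open>z\<^sub>n\<close>. A
  partition so fine that every cell lies in one of the sets on which \<open>f\<^sub>n\<close> is constant, and either
  inside or outside \<open>N\<close>, has two properties. First, the partition sum of \<open>f\<^sub>n\<close> is exactly \<open>z\<^sub>n\<close>, whatever the tags: inside a set of
  constancy the tags do not matter, and the measures of the cells add up by countable additivity
  (\<open>elementary_integral_eq_partition_sum\<close>). Second, replacing \<open>f\<^sub>n\<close> by \<open>f\<close> changes the term of a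
  cell \<open>\<alpha>\<close> by at most \<open>u\<^sub>n \<bullet> \<mu>(\<alpha>)\<close>, hence the sum by at most \<open>v\<^sub>n = u\<^sub>n \<bullet> \<mu>(\<Omega>)\<close>
  (\<open>partition_sums_near_elementary_integral\<close>).

  Since the product preserves suprema of nonnegative sequences, \<open>v\<^sub>n\<close> decreases to 0. Any two \<open>z\<^sub>m\<close>, \<open>z\<^sub>n\<close>
  are within \<open>v\<^sub>m + v\<^sub>n\<close> of each other, because both approximate the sum over a common refinement. By
  Dedekind completeness \<open>z\<^sub>n\<close> converges to some \<open>z\<close> with \<open>\<bar>z\<^sub>n - z\<bar> \<le> v\<^sub>n\<close>, so sufficiently fine
  partition sums of \<open>f\<close> are within \<open>2 v\<^sub>n\<close> of \<open>z\<close>. The double sequence \<open>a\<^sub>i\<^sub>j = 2 v\<^sub>j\<close>, constant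
  in \<open>i\<close>, is then a (D)-sequence witnessing that \<open>z\<close> is the \<open>S\<^sup>*\<close>-integral
  (\<open>pavlakos_limit_is_S_star_integral\<close>). The reasoning applies to every approximating sequence, so
  every value of the Pavlakos integral is a value of the \<open>S\<^sup>*\<close>-integral; weak
  \<open>\<sigma>\<close>-distributivity makes the latter unique (\<open>S_star_has_integral_unique\<close>), and with it the former.\<close>


section \<open>Order limits in Riesz spaces\<close>

lemma isLub_UNIV_iff:
  "isLub UNIV S x \<longleftrightarrow> (\<forall>s\<in>S. s \<le> x) \<and> (\<forall>z. (\<forall>s\<in>S. s \<le> z) \<longrightarrow> x \<le> z)"
  unfolding isLub_def leastP_def isUb_def setle_def setge_def by auto

lemma isGlb_UNIV_iff:
  "isGlb UNIV S x \<longleftrightarrow> (\<forall>s\<in>S. x \<le> s) \<and> (\<forall>z. (\<forall>s\<in>S. z \<le> s) \<longrightarrow> z \<le> x)"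
  unfolding isGlb_def greatestP_def isLb_def setle_def setge_def by auto

lemma abs_le_iff_bounds:
  fixes x :: "'a::riesz_space"
  shows "\<bar>x\<bar> \<le> d \<longleftrightarrow> x \<le> d \<and> - x \<le> d"
  unfolding abs_lattice by simp

lemma abs_diff_le_add:
  fixes a :: "'a::riesz_space"
  assumes "\<bar>a - b\<bar> \<le> d" "\<bar>b - c\<bar> \<le> e"
  shows "\<bar>a - c\<bar> \<le> d + e"
proof -
  have "\<bar>a - c\<bar> \<le> \<bar>a - b\<bar> + \<bar>b - c\<bar>" using abs_triangle_ineq[of "a - b" "b - c"] by simp
  then show ?thesis using add_mono[OF assms] by (rule order_trans)
qed

text \<open>The elements of \<open>D\<close> and \<open>E\<close> vary independently, so the infimum can be taken over \<open>D\<close> first and then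
  over \<open>E\<close>.\<close>

lemma le_zero_if_le_sums:
  fixes x :: "'a::riesz_space"
  assumes "isGlb UNIV D 0" "isGlb UNIV E 0" "\<And>d e. d \<in> D \<Longrightarrow> e \<in> E \<Longrightarrow> x \<le> d + e"
  shows "x \<le> 0"
proof -
  have "x \<le> e" if e: "e \<in> E" for e
  proof -
    have "x - e \<le> d" if "d \<in> D" for d using assms(3)[OF that e] by (simp add: diff_le_eq)
    then have "x - e \<le> 0" using assms(1) unfolding isGlb_UNIV_iff by blast
    then show ?thesis by simp
  qed
  then show ?thesis using assms(2) unfolding isGlb_UNIV_iff by blast
qed

lemma order_convE:
  assumes "order_conv I le x l"
  obtains D where "D \<noteq> {}" "\<And>a b. a \<in> D \<Longrightarrow> b \<in> D \<Longrightarrow> \<exists>c\<in>D. c \<le> a \<and> c \<le> b" "isGlb UNIV D 0"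
    "\<And>d. d \<in> D \<Longrightarrow> \<exists>i0\<in>I. \<forall>i\<in>I. le i0 i \<longrightarrow> \<bar>x i - l\<bar> \<le> d"
  using assms[unfolded order_conv_def] by (elim exE conjE) metis

lemma directed_index_upper:
  assumes "directed_index I le" "i \<in> I" "j \<in> I"
  obtains k where "k \<in> I" "le i k" "le j k"
  using assms unfolding directed_index_def by blast

lemma directed_index_trans:
  assumes "directed_index I le" "i \<in> I" "j \<in> I" "k \<in> I" "le i j" "le j k"
  shows "le i k"
  using assms unfolding directed_index_def by metis

lemma directed_index_nat: "directed_index (UNIV :: nat set) (\<le>)"
  unfolding directed_index_def by (auto intro: max.cobounded1 max.cobounded2)

lemma directed_index_finite_subsets: "directed_index {F. finite F \<and> F \<subseteq> A} (\<subseteq>)"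
  unfolding directed_index_def
proof (intro conjI ballI impI)
  fix F G assume "F \<in> {F. finite F \<and> F \<subseteq> A}" "G \<in> {F. finite F \<and> F \<subseteq> A}"
  then show "\<exists>K\<in>{F. finite F \<and> F \<subseteq> A}. F \<subseteq> K \<and> G \<subseteq> K" by (intro bexI[of _ "F \<union> G"]) auto
qed auto

lemma order_conv_diff:
  assumes I: "directed_index I le" and "order_conv I le x l" "order_conv I le y m"
  shows "order_conv I le (\<lambda>i. x i - y i) (l - m)"
proof -
  obtain D where D: "D \<noteq> {}" "\<And>a b. a \<in> D \<Longrightarrow> b \<in> D \<Longrightarrow> \<exists>c\<in>D. c \<le> a \<and> c \<le> b" "isGlb UNIV D 0"
    "\<And>d. d \<in> D \<Longrightarrow> \<exists>i0\<in>I. \<forall>i\<in>I. le i0 i \<longrightarrow> \<bar>x i - l\<bar> \<le> d"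
    using assms(2) by (rule order_convE) blast
  obtain E where E: "E \<noteq> {}" "\<And>a b. a \<in> E \<Longrightarrow> b \<in> E \<Longrightarrow> \<exists>c\<in>E. c \<le> a \<and> c \<le> b" "isGlb UNIV E 0"
    "\<And>e. e \<in> E \<Longrightarrow> \<exists>i0\<in>I. \<forall>i\<in>I. le i0 i \<longrightarrow> \<bar>y i - m\<bar> \<le> e"
    using assms(3) by (rule order_convE) blast
  let ?S = "{d + e | d e. d \<in> D \<and> e \<in> E}"
  show ?thesis
    unfolding order_conv_def
  proof (intro exI[of _ ?S] conjI ballI)
    show "?S \<noteq> {}" using D(1) E(1) by blast
  next
    fix a b assume "a \<in> ?S" "b \<in> ?S"
    then obtain d e d' e' where *: "d \<in> D" "e \<in> E" "d' \<in> D" "e' \<in> E" "a = d + e" "b = d' + e'" by blast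
    obtain c where c: "c \<in> D" "c \<le> d" "c \<le> d'" using D(2)[OF *(1,3)] by blast
    obtain c' where c': "c' \<in> E" "c' \<le> e" "c' \<le> e'" using E(2)[OF *(2,4)] by blast
    have "c + c' \<in> ?S" "c + c' \<le> a" "c + c' \<le> b" using * c c' by (auto intro: add_mono)
    then show "\<exists>c\<in>?S. c \<le> a \<and> c \<le> b" by blast
  next
    have "0 \<le> d" if "d \<in> D" for d using D(3) that unfolding isGlb_UNIV_iff by blast
    moreover have "0 \<le> e" if "e \<in> E" for e using E(3) that unfolding isGlb_UNIV_iff by blast
    ultimately show "isGlb UNIV ?S 0"
      unfolding isGlb_UNIV_iff using le_zero_if_le_sums[OF D(3) E(3)] by fastforce
  next
    fix s assume "s \<in> ?S"
    then obtain d e where de: "d \<in> D" "e \<in> E" "s = d + e" by blast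
    obtain i where i: "i \<in> I" "\<And>k. k \<in> I \<Longrightarrow> le i k \<Longrightarrow> \<bar>x k - l\<bar> \<le> d" using D(4)[OF de(1)] by blast
    obtain j where j: "j \<in> I" "\<And>k. k \<in> I \<Longrightarrow> le j k \<Longrightarrow> \<bar>y k - m\<bar> \<le> e" using E(4)[OF de(2)] by blast
    obtain h where h: "h \<in> I" "le i h" "le j h" using directed_index_upper[OF I i(1) j(1)] .
    have "\<bar>(x k - y k) - (l - m)\<bar> \<le> s" if k: "k \<in> I" "le h k" for k
    proof -
      have "\<bar>x k - l\<bar> \<le> d" "\<bar>y k - m\<bar> \<le> e"
        using i j h k directed_index_trans[OF I] by metis+
      moreover have "\<bar>(x k - y k) - (l - m)\<bar> \<le> \<bar>x k - l\<bar> + \<bar>y k - m\<bar>"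
        by (rule order_trans[OF eq_refl abs_triangle_ineq4]) (simp add: algebra_simps)
      ultimately show ?thesis unfolding de(3) using add_mono order_trans by blast
    qed
    then show "\<exists>i0\<in>I. \<forall>i\<in>I. le i0 i \<longrightarrow> \<bar>(x i - y i) - (l - m)\<bar> \<le> s" using h(1) by blast
  qed
qed

lemma order_conv_unique:
  assumes "directed_index I le" "order_conv I le x l" "order_conv I le x m"
  shows "l = m"
proof -
  have "order_conv I le (\<lambda>i. 0) (l - m)" using order_conv_diff[OF assms] by simp
  then obtain D where "isGlb UNIV D 0" "\<And>d. d \<in> D \<Longrightarrow> \<exists>i0\<in>I. \<forall>i\<in>I. le i0 i \<longrightarrow> \<bar>0 - (l - m)\<bar> \<le> d"
    by (rule order_convE) blast
  moreover have "le i i" if "i \<in> I" for i using assms(1) that unfolding directed_index_def by blast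
  ultimately have "\<bar>l - m\<bar> \<le> 0" unfolding isGlb_UNIV_iff by (metis abs_minus_cancel diff_0)
  then show ?thesis by simp
qed

text \<open>For an increasing net, order convergence amounts to having the limit as supremum of the range.
  This lemma and its converse translate between the limits in the definitions of the integrals and the suprema that the product preserves.\<close>

lemma mono_order_conv_imp_isLub:
  fixes x :: "'i \<Rightarrow> 'a::riesz_space"
  assumes I: "directed_index I le"
    and mono: "\<And>i j. i \<in> I \<Longrightarrow> j \<in> I \<Longrightarrow> le i j \<Longrightarrow> x i \<le> x j"
    and "order_conv I le x l"
  shows "isLub UNIV (x ` I) l"
proof -
  obtain D where glb: "isGlb UNIV D 0"
    and D: "\<And>d. d \<in> D \<Longrightarrow> \<exists>i0\<in>I. \<forall>i\<in>I. le i0 i \<longrightarrow> \<bar>x i - l\<bar> \<le> d"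
    using assms(3) by (rule order_convE) blast
  have glbD: "z \<le> 0" if "\<And>d. d \<in> D \<Longrightarrow> z \<le> d" for z
    using glb that unfolding isGlb_UNIV_iff by blast
  have "x i \<le> l" if i: "i \<in> I" for i
  proof -
    have "x i - l \<le> d" if d: "d \<in> D" for d
    proof -
      obtain j where j: "j \<in> I" "\<And>k. k \<in> I \<Longrightarrow> le j k \<Longrightarrow> \<bar>x k - l\<bar> \<le> d" using D[OF d] by blast
      obtain k where k: "k \<in> I" "le i k" "le j k" using directed_index_upper[OF I i j(1)] .
      have "x i - l \<le> x k - l" using mono[OF i k(1,2)] by simp
      also have "\<dots> \<le> d" using j(2)[OF k(1,3)] unfolding abs_le_iff_bounds by blast
      finally show ?thesis .
    qed
    then have "x i - l \<le> 0" by (rule glbD)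
    then show ?thesis by simp
  qed
  moreover have "l \<le> z" if z: "\<And>i. i \<in> I \<Longrightarrow> x i \<le> z" for z
  proof -
    have "l - z \<le> d" if d: "d \<in> D" for d
    proof -
      obtain j where j: "j \<in> I" "\<And>k. k \<in> I \<Longrightarrow> le j k \<Longrightarrow> \<bar>x k - l\<bar> \<le> d" using D[OF d] by blast
      have "\<bar>x j - l\<bar> \<le> d" using I j unfolding directed_index_def by blast
      then have "l - x j \<le> d" unfolding abs_le_iff_bounds by simp
      moreover have "l - z \<le> l - x j" using z[OF j(1)] by simp
      ultimately show ?thesis by (rule order_trans[rotated])
    qed
    then have "l - z \<le> 0" by (rule glbD)
    then show ?thesis by simp
  qed
  ultimately show ?thesis unfolding isLub_UNIV_iff by blast
qed

lemma mono_isLub_imp_order_conv: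
  fixes x :: "'i \<Rightarrow> 'a::riesz_space"
  assumes I: "directed_index I le"
    and mono: "\<And>i j. i \<in> I \<Longrightarrow> j \<in> I \<Longrightarrow> le i j \<Longrightarrow> x i \<le> x j"
    and lub: "isLub UNIV (x ` I) l"
  shows "order_conv I le x l"
proof (rule order_convI[OF I, where y = "\<lambda>i. l - x i"])
  have ub: "x i \<le> l" if "i \<in> I" for i using lub that unfolding isLub_UNIV_iff by blast
  show "l - x e \<le> l - x d" if "d \<in> I" "e \<in> I" "le d e" for d e using mono[OF that] by simp
  show "isGlb UNIV ((\<lambda>i. l - x i) ` I) 0"
    unfolding isGlb_UNIV_iff
  proof (intro conjI allI impI)
    fix z assume "\<forall>s\<in>(\<lambda>i. l - x i) ` I. z \<le> s"
    then have "\<forall>s\<in>x ` I. s \<le> l - z" by (auto simp: le_diff_eq add.commute)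
    then have "l \<le> l - z" using lub unfolding isLub_UNIV_iff by blast
    then show "z \<le> 0" by (simp add: le_diff_eq)
  qed (use ub in auto)
  fix d assume d: "d \<in> I"
  have "\<bar>x i - l\<bar> \<le> l - x d" if "i \<in> I" "le d i" for i
  proof -
    have "0 \<le> l - x d" "x i - l \<le> 0" using ub d that by auto
    then have "x i - l \<le> l - x d" by (rule order_trans[rotated])
    then show ?thesis unfolding abs_le_iff_bounds using mono[OF d that] by simp
  qed
  then show "\<exists>i0\<in>I. \<forall>i\<in>I. le i0 i \<longrightarrow> \<bar>x i - l\<bar> \<le> l - x d" using d by blast
qed


section \<open>Sums of nonnegative families\<close>

text \<open>For nonnegative terms the unconditional sum is the supremum of the finite subsums. This form
  needs no majorizing net, and regrouping the terms is a matter of comparing upper bounds.\<close>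

definition has_sup_sum :: "('k \<Rightarrow> 'a::riesz_space) \<Rightarrow> 'k set \<Rightarrow> 'a \<Rightarrow> bool" where
  "has_sup_sum g A s \<longleftrightarrow> isLub UNIV (sum g ` {F. finite F \<and> F \<subseteq> A}) s"

lemma has_sup_sum_iff:
  "has_sup_sum g A s \<longleftrightarrow> (\<forall>F. finite F \<longrightarrow> F \<subseteq> A \<longrightarrow> sum g F \<le> s) \<and>
     (\<forall>z. (\<forall>F. finite F \<longrightarrow> F \<subseteq> A \<longrightarrow> sum g F \<le> z) \<longrightarrow> s \<le> z)"
  unfolding has_sup_sum_def isLub_UNIV_iff by auto

lemma has_sup_sumI:
  assumes "\<And>F. finite F \<Longrightarrow> F \<subseteq> A \<Longrightarrow> sum g F \<le> s"
    and "\<And>z. (\<And>F. finite F \<Longrightarrow> F \<subseteq> A \<Longrightarrow> sum g F \<le> z) \<Longrightarrow> s \<le> z"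
  shows "has_sup_sum g A s"
  unfolding has_sup_sum_iff using assms by blast

lemma has_sup_sum_upper:
  "has_sup_sum g A s \<Longrightarrow> finite F \<Longrightarrow> F \<subseteq> A \<Longrightarrow> sum g F \<le> s"
  unfolding has_sup_sum_iff by blast

lemma has_sup_sum_least:
  "has_sup_sum g A s \<Longrightarrow> (\<And>F. finite F \<Longrightarrow> F \<subseteq> A \<Longrightarrow> sum g F \<le> z) \<Longrightarrow> s \<le> z"
  unfolding has_sup_sum_iff by blast

lemma has_sup_sum_cong:
  assumes "\<And>k. k \<in> A \<Longrightarrow> g k = h k"
  shows "has_sup_sum g A s \<longleftrightarrow> has_sup_sum h A s"
proof -
  have "sum g F = sum h F" if "F \<subseteq> A" for F using assms that by (intro sum.cong) auto
  then show ?thesis unfolding has_sup_sum_iff by simp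
qed

lemma unconditional_sum_iff_has_sup_sum:
  fixes g :: "'k \<Rightarrow> 'a::riesz_space"
  assumes "\<And>k. k \<in> A \<Longrightarrow> 0 \<le> g k"
  shows "unconditional_sum g A s \<longleftrightarrow> has_sup_sum g A s"
proof -
  have mono: "sum g F \<le> sum g G"
    if "F \<in> {F. finite F \<and> F \<subseteq> A}" "G \<in> {F. finite F \<and> F \<subseteq> A}" "F \<subseteq> G" for F G
    using that assms by (intro sum_mono2) auto
  show ?thesis
    unfolding unconditional_sum_def has_sup_sum_def
  proof
    assume "order_conv {F. finite F \<and> F \<subseteq> A} (\<subseteq>) (sum g) s"
    with directed_index_finite_subsets mono
    show "isLub UNIV (sum g ` {F. finite F \<and> F \<subseteq> A}) s" by (rule mono_order_conv_imp_isLub)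
  next
    assume "isLub UNIV (sum g ` {F. finite F \<and> F \<subseteq> A}) s"
    with directed_index_finite_subsets mono
    show "order_conv {F. finite F \<and> F \<subseteq> A} (\<subseteq>) (sum g) s" by (rule mono_isLub_imp_order_conv)
  qed
qed

lemma unconditional_sum_diff:
  assumes "unconditional_sum g A s" "unconditional_sum h A t"
  shows "unconditional_sum (\<lambda>k. g k - h k) A (s - t)"
  using order_conv_diff[OF directed_index_finite_subsets assms[unfolded unconditional_sum_def]]
  unfolding unconditional_sum_def sum_subtractf .

lemma unconditional_sum_unique:
  "unconditional_sum g A s \<Longrightarrow> unconditional_sum g A t \<Longrightarrow> s = t"
  unfolding unconditional_sum_def by (rule order_conv_unique[OF directed_index_finite_subsets])

lemma has_sup_sum_exists_if_bounded:
  fixes g :: "'k \<Rightarrow> 'z::{riesz_space, conditionally_complete_lattice}"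
  assumes "\<And>F. finite F \<Longrightarrow> F \<subseteq> A \<Longrightarrow> sum g F \<le> b"
  obtains s where "has_sup_sum g A s"
proof
  let ?S = "sum g ` {F. finite F \<and> F \<subseteq> A}"
  have bdd: "bdd_above ?S" using assms by (intro bdd_aboveI[of _ b]) auto
  have "sum g F \<le> Sup ?S" if "finite F" "F \<subseteq> A" for F using that bdd by (intro cSup_upper) auto
  moreover have "Sup ?S \<le> z" if "\<And>F. finite F \<Longrightarrow> F \<subseteq> A \<Longrightarrow> sum g F \<le> z" for z
    using that by (intro cSup_least) auto
  ultimately show "has_sup_sum g A (Sup ?S)" by (rule has_sup_sumI)
qed

text \<open>An upper bound \<open>z\<close> of all finite subsums dominates the sum of the first \<open>n\<close> blocks plus any finite
  subsum of the later ones: the supremum over one more block is taken while all other terms are kept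
  fixed.\<close>

lemma has_sup_sum_UNION:
  fixes g :: "'k \<Rightarrow> 'a::riesz_space"
  assumes disj: "disjoint_family P" and blocks: "\<And>i::nat. has_sup_sum g (P i) (s i)"
    and lub: "isLub UNIV (range (\<lambda>n. \<Sum>i<n. s i)) t"
  shows "has_sup_sum g (\<Union>i. P i) t"
proof (rule has_sup_sumI)
  fix F assume F: "finite F" "F \<subseteq> (\<Union>i. P i)"
  then obtain i where i: "\<And>k. k \<in> F \<Longrightarrow> k \<in> P (i k)" by (metis UN_E subsetD)
  obtain n where n: "i k < n" if "k \<in> F" for k
    using F(1) by (metis finite_imageI finite_nat_set_iff_bounded imageI)
  have "F = (\<Union>j<n. F \<inter> P j)" using i n by blast
  then have "sum g F = sum g (\<Union>j<n. F \<inter> P j)" by simp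
  also have "\<dots> = (\<Sum>j<n. sum g (F \<inter> P j))"
    using F(1) disj by (intro sum.UNION_disjoint) (auto simp: disjoint_family_on_def)
  also have "\<dots> \<le> (\<Sum>j<n. s j)" using F(1) by (intro sum_mono has_sup_sum_upper[OF blocks]) auto
  also have "\<dots> \<le> t" using lub unfolding isLub_UNIV_iff by blast
  finally show "sum g F \<le> t" .
next
  fix z assume z: "\<And>F. finite F \<Longrightarrow> F \<subseteq> (\<Union>i. P i) \<Longrightarrow> sum g F \<le> z"
  have "(\<Sum>i<n. s i) + sum g G \<le> z" if "finite G" "G \<subseteq> (\<Union>i\<in>{n..}. P i)" for n G
    using that
  proof (induction n arbitrary: G)
    case 0
    then show ?case using z[of G] by simp
  next
    case (Suc n)
    have "sum g F \<le> z - (\<Sum>i<n. s i) - sum g G" if F: "finite F" "F \<subseteq> P n" for F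
    proof -
      have "F \<inter> G = {}" 
      proof (rule equals0I)
        fix k assume "k \<in> F \<inter> G"
        then have "k \<in> P n" "k \<in> (\<Union>i\<in>{Suc n..}. P i)" using F(2) Suc.prems(2) by blast+
        then obtain i where "k \<in> P n" "i > n" "k \<in> P i" by (auto simp: Suc_le_eq)
        moreover have "P n \<inter> P i = {}" using disj \<open>i > n\<close> unfolding disjoint_family_on_def by simp
        ultimately show False by blast
      qed
      then have "sum g (F \<union> G) = sum g F + sum g G" using F Suc.prems by (intro sum.union_disjoint)
      moreover have "(\<Sum>i<n. s i) + sum g (F \<union> G) \<le> z"
      proof (rule Suc.IH)
        show "finite (F \<union> G)" using F(1) Suc.prems(1) by simp
        have "(\<Union>i\<in>{Suc n..}. P i) \<subseteq> (\<Union>i\<in>{n..}. P i)" by (intro UN_mono) auto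
        moreover have "P n \<subseteq> (\<Union>i\<in>{n..}. P i)" by auto
        ultimately show "F \<union> G \<subseteq> (\<Union>i\<in>{n..}. P i)"
          using F(2) Suc.prems(2) by (intro Un_least) (auto intro: order_trans)
      qed
      ultimately show ?thesis by (simp add: algebra_simps)
    qed
    then have "s n \<le> z - (\<Sum>i<n. s i) - sum g G" by (rule has_sup_sum_least[OF blocks])
    then show ?case by (simp add: algebra_simps)
  qed
  from this[of "{}"] have "(\<Sum>i<n. s i) \<le> z" for n by simp
  then show "t \<le> z" using lub unfolding isLub_UNIV_iff by blast
qed


lemma has_sup_sum_empty: "has_sup_sum g {} 0"
  unfolding has_sup_sum_iff by auto

lemma has_sup_sum_singleton:
  assumes "0 \<le> g k"
  shows "has_sup_sum g {k} (g k)"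
proof (rule has_sup_sumI)
  show "sum g F \<le> g k" if "F \<subseteq> {k}" for F
    using subset_singletonD[OF that] assms by auto
  show "g k \<le> z" if "\<And>F. finite F \<Longrightarrow> F \<subseteq> {k} \<Longrightarrow> sum g F \<le> z" for z
    using that[of "{k}"] by simp
qed

lemma has_sup_sum_mono_neutral:
  assumes "A \<subseteq> B" "\<And>k. k \<in> B - A \<Longrightarrow> g k = 0" and s: "has_sup_sum g A s"
  shows "has_sup_sum g B s"
proof (rule has_sup_sumI)
  fix F assume F: "finite F" "F \<subseteq> B"
  have "sum g (F \<inter> A) = sum g F" using F assms(2) by (intro sum.mono_neutral_left) auto
  moreover have "sum g (F \<inter> A) \<le> s" using F(1) by (intro has_sup_sum_upper[OF s]) auto
  ultimately show "sum g F \<le> s" by simp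
next
  fix z assume "\<And>F. finite F \<Longrightarrow> F \<subseteq> B \<Longrightarrow> sum g F \<le> z"
  then show "s \<le> z" using assms(1) by (intro has_sup_sum_least[OF s]) auto
qed

lemma isLub_partial_sums:
  fixes s :: "nat \<Rightarrow> 'a::riesz_space"
  assumes "\<And>i. 0 \<le> s i" "order_conv_seq (\<lambda>n. \<Sum>i<n. s i) t"
  shows "isLub UNIV (range (\<lambda>n. \<Sum>i<n. s i)) t"
proof (rule mono_order_conv_imp_isLub[OF directed_index_nat _ assms(2)])
  show "(\<Sum>k<i. s k) \<le> (\<Sum>k<j. s k)" if "i \<le> j" for i j
    using that assms(1) by (intro sum_mono2) auto
qed

lemma has_sup_sum_imp_isLub_partial_sums:
  fixes s :: "nat \<Rightarrow> 'a::riesz_space"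
  assumes pos: "\<And>i. 0 \<le> s i" and t: "has_sup_sum s UNIV t"
  shows "isLub UNIV (range (\<lambda>n. \<Sum>i<n. s i)) t"
  unfolding isLub_UNIV_iff
proof (intro conjI allI impI)
  show "\<forall>x\<in>range (\<lambda>n. \<Sum>i<n. s i). x \<le> t" using has_sup_sum_upper[OF t] by blast
  fix z assume z: "\<forall>x\<in>range (\<lambda>n. \<Sum>i<n. s i). x \<le> z"
  show "t \<le> z"
  proof (rule has_sup_sum_least[OF t])
    fix F :: "nat set" assume F: "finite F"
    then obtain n where "F \<subseteq> {..<n}" using finite_nat_bounded by blast
    then have "sum s F \<le> (\<Sum>i<n. s i)" using pos by (intro sum_mono2) auto
    also have "\<dots> \<le> z" using z by blast
    finally show "sum s F \<le> z" .
  qed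
qed


section \<open>Positive sigma-additive measures and products\<close>

text \<open>In the constant sequence of empty sets, the sum of two terms is at most the sum of all, which is
  again the measure of the empty set.\<close>

lemma sigma_additive_empty:
  assumes "sigma_additive H \<mu>" "{} \<in> H" "0 \<le> \<mu> {}"
  shows "\<mu> {} = 0"
proof -
  have "unconditional_sum (\<lambda>n::nat. \<mu> {}) UNIV (\<mu> {})"
    using assms(1)[unfolded sigma_additive_def, rule_format, of "\<lambda>n. {}"] assms(2)
    by (auto simp: disjoint_family_on_def)
  then have s: "has_sup_sum (\<lambda>n::nat. \<mu> {}) UNIV (\<mu> {})"
    using unconditional_sum_iff_has_sup_sum[of UNIV "\<lambda>n::nat. \<mu> {}"] assms(3) by simp
  have "\<mu> {} + \<mu> {} \<le> \<mu> {}" using has_sup_sum_upper[OF s, of "{0, 1}"] by simp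
  then show ?thesis using assms(3) by simp
qed

text \<open>The map \<open>h\<close> is either the identity or multiplication by a fixed nonnegative element; the latter
  carries countable additivity from the space of the measure to the space of the integral.\<close>

lemma sigma_additive_countable_partition:
  fixes \<mu> :: "'w set \<Rightarrow> 'y::riesz_space" and h :: "'y \<Rightarrow> 'b::riesz_space"
  assumes "sigma_algebra \<Omega> H" and pos: "\<forall>A\<in>H. 0 \<le> \<mu> A" and add: "sigma_additive H \<mu>"
    and P: "countable P" "disjoint P" "P \<subseteq> H"
    and h: "linear h" "\<And>y. 0 \<le> y \<Longrightarrow> 0 \<le> h y"
    and h_sup: "\<And>(y :: nat \<Rightarrow> 'y) s. (\<And>n. 0 \<le> y n) \<Longrightarrow> isLub UNIV (range y) s \<Longrightarrow>
        isLub UNIV (range (\<lambda>n. h (y n))) (h s)"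
  shows "has_sup_sum (\<lambda>\<alpha>. h (\<mu> \<alpha>)) P (h (\<mu> (\<Union>P)))"
proof -
  interpret sigma_algebra \<Omega> H by fact
  have \<mu>0: "\<mu> {} = 0" using sigma_additive_empty[OF add] pos by auto
  \<comment> \<open>Sigma-additivity speaks of sequences, but \<open>P\<close> may be finite; blocks of at most one cell cover
    both cases.\<close>
  define B where "B n = {\<alpha>\<in>P. to_nat_on P \<alpha> = n}" for n
  have B: "B n = {} \<or> (\<exists>\<alpha>\<in>P. B n = {\<alpha>})" for n
    using inj_on_to_nat_on[OF P(1)] unfolding B_def inj_on_def by blast
  have BH: "\<Union>(B n) \<in> H" for n using B[of n] P(3) by auto
  have disjB: "disjoint_family B" unfolding B_def disjoint_family_on_def by auto
  have "disjoint_family (\<lambda>n. \<Union>(B n))"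
    unfolding disjoint_family_on_def
  proof (intro ballI impI equals0I)
    fix m n w assume "m \<noteq> n" "w \<in> \<Union>(B m) \<inter> \<Union>(B n)"
    then obtain \<alpha> \<beta> where "\<alpha> \<in> P" "\<beta> \<in> P" "\<alpha> \<noteq> \<beta>" and w: "w \<in> \<alpha> \<inter> \<beta>"
      unfolding B_def by auto
    with P(2) have "\<alpha> \<inter> \<beta> = {}" by (meson disjointD)
    with w show False by simp
  qed
  then have "unconditional_sum (\<lambda>n. \<mu> (\<Union>(B n))) UNIV (\<mu> (\<Union>n. \<Union>(B n)))"
    using add[unfolded sigma_additive_def, rule_format, of "\<lambda>n. \<Union>(B n)"] BH by (simp add: image_subset_iff)
  moreover have "(\<Union>n. \<Union>(B n)) = \<Union>P" unfolding B_def by blast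
  ultimately have "has_sup_sum (\<lambda>n. \<mu> (\<Union>(B n))) UNIV (\<mu> (\<Union>P))"
    using unconditional_sum_iff_has_sup_sum[of UNIV "\<lambda>n. \<mu> (\<Union>(B n))"] pos BH by simp
  then have "isLub UNIV (range (\<lambda>n. \<Sum>i<n. \<mu> (\<Union>(B i)))) (\<mu> (\<Union>P))"
    using pos BH by (intro has_sup_sum_imp_isLub_partial_sums) auto
  then have "isLub UNIV (range (\<lambda>n. h (\<Sum>i<n. \<mu> (\<Union>(B i))))) (h (\<mu> (\<Union>P)))"
    using pos BH by (intro h_sup) (auto intro: sum_nonneg)
  then have lub: "isLub UNIV (range (\<lambda>n. \<Sum>i<n. h (\<mu> (\<Union>(B i))))) (h (\<mu> (\<Union>P)))"
    unfolding linear_sum[OF h(1)] .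
  have "has_sup_sum (\<lambda>\<alpha>. h (\<mu> \<alpha>)) (B n) (h (\<mu> (\<Union>(B n))))" for n
    using B[of n]
  proof
    assume "B n = {}"
    then show ?thesis using has_sup_sum_empty \<mu>0 linear_0[OF h(1)] by simp
  next
    assume "\<exists>\<alpha>\<in>P. B n = {\<alpha>}"
    then obtain \<alpha> where \<alpha>: "\<alpha> \<in> P" "B n = {\<alpha>}" by blast
    then have "0 \<le> h (\<mu> \<alpha>)" using h(2) pos P(3) by blast
    from has_sup_sum_singleton[of "\<lambda>\<alpha>. h (\<mu> \<alpha>)", OF this] show ?thesis unfolding \<alpha>(2) by simp
  qed
  from has_sup_sum_UNION[OF disjB this lub]
  have "has_sup_sum (\<lambda>\<alpha>. h (\<mu> \<alpha>)) (\<Union>i. B i) (h (\<mu> (\<Union>P)))" .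
  moreover have "(\<Union>i. B i) = P" unfolding B_def by blast
  ultimately show ?thesis by simp
qed


section \<open>Countable measurable partitions\<close>

lemma choice_function_exists:
  obtains \<delta> where "choice_function \<Omega> \<delta>"
  using that[of "\<lambda>\<alpha>. SOME w. w \<in> \<alpha>"] unfolding choice_function_def by (simp add: some_in_eq)

lemma countable_partition_of_sequence:
  fixes A :: "nat \<Rightarrow> 'w set"
  assumes "sigma_algebra \<Omega> H" and A: "range A \<subseteq> H" "disjoint_family A"
  shows "\<exists>Q\<in>countable_partitions \<Omega> H. \<forall>\<alpha>\<in>Q. (\<exists>i. \<alpha> \<subseteq> A i) \<or> \<alpha> \<inter> (\<Union>i. A i) = {}"
proof
  interpret sigma_algebra \<Omega> H by fact
  let ?Q = "insert (\<Omega> - (\<Union>i. A i)) (range A) - {{}}"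
  have sub: "A i \<subseteq> \<Omega>" for i using A(1) sets_into_space by blast
  have "disjoint ?Q"
  proof (rule disjointI)
    fix \<alpha> \<beta> assume *: "\<alpha> \<in> ?Q" "\<beta> \<in> ?Q" "\<alpha> \<noteq> \<beta>"
    have "A i \<inter> A j = {}" if "A i \<noteq> A j" for i j
      using that A(2) unfolding disjoint_family_on_def by (metis UNIV_I)
    moreover have "A i \<inter> (\<Omega> - (\<Union>i. A i)) = {}" "(\<Omega> - (\<Union>i. A i)) \<inter> A i = {}" for i by auto
    ultimately show "\<alpha> \<inter> \<beta> = {}" using * by (elim DiffE insertE imageE) simp_all
  qed
  have "(\<Union>i. A i) \<subseteq> \<Omega>" using sub by (rule UN_least)
  moreover have "\<Union>(S - {{}}) = \<Union>S" for S :: "'w set set" by auto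
  ultimately have "\<Union>?Q = \<Omega>" by (simp add: Un_absorb2)
  with \<open>disjoint ?Q\<close> have "partition_on \<Omega> ?Q" unfolding partition_on_def by simp
  moreover have "\<Omega> - (\<Union>i. A i) \<in> H" using A(1) by auto
  ultimately show "?Q \<in> countable_partitions \<Omega> H"
    using A(1) unfolding countable_partitions_def by auto
  show "\<forall>\<alpha>\<in>?Q. (\<exists>i. \<alpha> \<subseteq> A i) \<or> \<alpha> \<inter> (\<Union>i. A i) = {}" by auto
qed

lemma countable_partitions_common_refinement:
  assumes "sigma_algebra \<Omega> H" "P \<in> countable_partitions \<Omega> H" "Q \<in> countable_partitions \<Omega> H"
  obtains R where "R \<in> countable_partitions \<Omega> H" "refines \<Omega> R P" "refines \<Omega> R Q"
proof
  interpret sigma_algebra \<Omega> H by fact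
  let ?R = "common_refinement {P, Q}"
  have PQ: "partition_on \<Omega> P" "partition_on \<Omega> Q" "countable P" "countable Q" "P \<subseteq> H" "Q \<subseteq> H"
    using assms(2,3) unfolding countable_partitions_def by auto
  then show "refines \<Omega> ?R P" "refines \<Omega> ?R Q" by (auto intro: refines_common_refinement)
  have sub: "?R \<subseteq> (\<lambda>(\<alpha>, \<beta>). \<alpha> \<inter> \<beta>) ` (P \<times> Q)"
    unfolding common_refinement by auto
  have "countable ?R" by (rule countable_subset[OF sub]) (use PQ in auto)
  moreover have "(\<lambda>(\<alpha>, \<beta>). \<alpha> \<inter> \<beta>) ` (P \<times> Q) \<subseteq> H"
  proof (rule image_subsetI)
    show "(case x of (\<alpha>, \<beta>) \<Rightarrow> \<alpha> \<inter> \<beta>) \<in> H" if "x \<in> P \<times> Q" for x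
      using that PQ(5,6) by (auto split: prod.split)
  qed
  then have "?R \<subseteq> H" using sub by (rule order_trans[rotated])
  moreover have "partition_on \<Omega> ?R" using PQ by (intro partition_on_common_refinement) auto
  ultimately show "?R \<in> countable_partitions \<Omega> H" unfolding countable_partitions_def by blast
qed


section \<open>Partition sums of a Pavlakos integrable function\<close>

locale positive_product_measure =
  fixes bp :: "'x::riesz_space \<Rightarrow> 'y::riesz_space \<Rightarrow> 'z::{riesz_space, conditionally_complete_lattice}"
    and \<Omega> :: "'w set" and H :: "'w set set" and \<mu> :: "'w set \<Rightarrow> 'y"
  assumes product: "riesz_product bp"
    and algebra: "sigma_algebra \<Omega> H"
    and positive: "\<forall>A\<in>H. 0 \<le> \<mu> A"
    and additive: "sigma_additive H \<mu>"
begin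

interpretation sigma_algebra \<Omega> H by (rule algebra)

lemma bilinear: "bilinear bp"
  using product unfolding riesz_product_def by blast

lemma product_isotone: "0 \<le> x \<Longrightarrow> x \<le> x' \<Longrightarrow> 0 \<le> y \<Longrightarrow> y \<le> y' \<Longrightarrow> bp x y \<le> bp x' y'"
  using product unfolding riesz_product_def by blast

lemma product_isLub_left:
  fixes x :: "nat \<Rightarrow> 'x"
  shows "(\<And>n. 0 \<le> x n) \<Longrightarrow> 0 \<le> y \<Longrightarrow> isLub UNIV (range x) s \<Longrightarrow>
    isLub UNIV (range (\<lambda>n. bp (x n) y)) (bp s y)"
  using product unfolding riesz_product_def by blast

lemma product_isLub_right:
  fixes y :: "nat \<Rightarrow> 'y"
  shows "0 \<le> x \<Longrightarrow> (\<And>n. 0 \<le> y n) \<Longrightarrow> isLub UNIV (range y) s \<Longrightarrow>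
    isLub UNIV (range (\<lambda>n. bp x (y n))) (bp x s)"
  using product unfolding riesz_product_def by blast

lemma product_nonneg:
  assumes "0 \<le> x" "0 \<le> y"
  shows "0 \<le> bp x y"
  using product_isotone[of 0 x y y] bilinear_lzero[OF bilinear] assms by simp

lemma product_left_mono:
  assumes "x \<le> x'" "0 \<le> y"
  shows "bp x y \<le> bp x' y"
  using product_nonneg[of "x' - x" y] bilinear_lsub[OF bilinear, of x' x y] assms by simp

lemma abs_product_le:
  assumes "\<bar>x\<bar> \<le> u" "0 \<le> y"
  shows "\<bar>bp x y\<bar> \<le> bp u y"
proof -
  have "x \<le> u" "- x \<le> u" using assms(1) unfolding abs_le_iff_bounds by auto
  then show ?thesis
    unfolding abs_le_iff_bounds using product_left_mono[of _ u y] assms(2)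
      bilinear_lneg[OF bilinear, of x y] by metis
qed

text \<open>The sequence \<open>u 0 - u n\<close> is nonnegative with supremum \<open>u 0\<close>, and the product preserves such suprema.\<close>

lemma product_decreasing_to_zero:
  assumes "decseq u" "isGlb UNIV (range u) 0" "0 \<le> y"
  shows "isGlb UNIV (range (\<lambda>n. bp (u n) y)) 0"
proof -
  have u: "0 \<le> u n" "u n \<le> u 0" for n
    using assms(1,2) unfolding isGlb_UNIV_iff decseq_def by auto
  have "isLub UNIV (range (\<lambda>n. u 0 - u n)) (u 0)"
    unfolding isLub_UNIV_iff
  proof (intro conjI allI impI)
    fix z assume "\<forall>s\<in>range (\<lambda>n. u 0 - u n). s \<le> z"
    then have "\<forall>s\<in>range u. u 0 - z \<le> s" by (auto simp: algebra_simps)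
    then have "u 0 - z \<le> 0" using assms(2) unfolding isGlb_UNIV_iff by blast
    then show "u 0 \<le> z" by simp
  qed (use u in auto)
  then have "isLub UNIV (range (\<lambda>n. bp (u 0 - u n) y)) (bp (u 0) y)"
    using u assms(3) by (intro product_isLub_left) auto
  then have lub: "isLub UNIV (range (\<lambda>n. bp (u 0) y - bp (u n) y)) (bp (u 0) y)"
    unfolding bilinear_lsub[OF bilinear] .
  show ?thesis
    unfolding isGlb_UNIV_iff
  proof (intro conjI allI impI)
    show "\<forall>s\<in>range (\<lambda>n. bp (u n) y). 0 \<le> s" using product_nonneg u(1) assms(3) by blast
    fix z assume "\<forall>s\<in>range (\<lambda>n. bp (u n) y). z \<le> s"
    then have "\<forall>s\<in>range (\<lambda>n. bp (u 0) y - bp (u n) y). s \<le> bp (u 0) y - z"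
      by (auto intro: diff_left_mono)
    then have "bp (u 0) y \<le> bp (u 0) y - z" using lub unfolding isLub_UNIV_iff by blast
    then show "z \<le> 0" by (simp add: le_diff_eq)
  qed
qed

lemma measure_empty: "\<mu> {} = 0"
  using sigma_additive_empty[OF additive] positive by auto

lemma product_measure_partition:
  assumes "countable P" "disjoint P" "P \<subseteq> H" "0 \<le> x"
  shows "has_sup_sum (\<lambda>\<alpha>. bp x (\<mu> \<alpha>)) P (bp x (\<mu> (\<Union>P)))"
proof (rule sigma_additive_countable_partition[OF algebra positive additive assms(1-3)])
  show "linear (bp x)" using bilinear unfolding bilinear_def by blast
  show "0 \<le> bp x y" if "0 \<le> y" for y using assms(4) that by (rule product_nonneg)
  show "isLub UNIV (range (\<lambda>n. bp x (y n))) (bp x s)"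
    if "\<And>n. 0 \<le> y n" "isLub UNIV (range y) s" for y :: "nat \<Rightarrow> 'y" and s
    using assms(4) that by (rule product_isLub_right)
qed

lemma measure_subset_null:
  assumes "A \<in> H" "N \<in> H" "A \<subseteq> N" "\<mu> N = 0"
  shows "\<mu> A = 0"
proof -
  have "has_sup_sum (\<lambda>\<alpha>. id (\<mu> \<alpha>)) {A, N - A} (id (\<mu> (\<Union>{A, N - A})))"
  proof (rule sigma_additive_countable_partition[OF algebra positive additive])
    show "disjoint {A, N - A}" by (auto simp: disjoint_def)
    show "linear (id :: 'y \<Rightarrow> 'y)" by (rule linear_id)
  qed (use assms(1,2) in auto)
  from has_sup_sum_upper[OF this, of "{A}"] have "\<mu> A \<le> \<mu> N"
    using assms(3) by (simp add: Un_absorb1)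
  then show ?thesis using assms(1,4) positive by (metis order_antisym)
qed


text \<open>On partitions that separate the sets of constancy of \<open>g\<close>, the partition sum is a regrouping, set
  by set, of the series defining the integral; cells outside all these sets contribute 0.\<close>

lemma elementary_integral_eq_partition_sum:
  assumes "elementary_pos_has_integral bp \<Omega> H \<mu> g p"
  obtains Q where "Q \<in> countable_partitions \<Omega> H"
    "\<And>P \<delta>. P \<in> countable_partitions \<Omega> H \<Longrightarrow> refines \<Omega> P Q \<Longrightarrow> choice_function \<Omega> \<delta> \<Longrightarrow>
       has_sup_sum (\<lambda>\<alpha>. bp (g (\<delta> \<alpha>)) (\<mu> \<alpha>)) P p"
proof -
  obtain a A where pos: "\<forall>w\<in>\<Omega>. 0 \<le> g w" and rep: "elementary_rep \<Omega> H g a A"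
    and lim: "order_conv_seq (\<lambda>n. \<Sum>i<n. bp (a i) (\<mu> (A i))) p"
    using assms unfolding elementary_pos_has_integral_def by blast
  have A: "range A \<subseteq> H" "disjoint_family A" "\<And>n w. w \<in> A n \<Longrightarrow> g w = a n"
    "\<And>w. w \<in> \<Omega> - (\<Union>n. A n) \<Longrightarrow> g w = 0"
    using rep unfolding elementary_rep_def by blast+
  have A_sub: "A i \<subseteq> \<Omega>" for i using A(1) sets_into_space by blast
  have a_pos: "0 \<le> a i" if "A i \<noteq> {}" for i using that A(3) A_sub pos by (metis ex_in_conv subsetD)
  have "0 \<le> bp (a i) (\<mu> (A i))" for i
    using a_pos[of i] A(1) positive product_nonneg measure_empty bilinear_rzero[OF bilinear]
    by (cases "A i = {}") auto
  from isLub_partial_sums[OF this lim]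
  have lub: "isLub UNIV (range (\<lambda>n. \<Sum>i<n. bp (a i) (\<mu> (A i)))) p" .
  obtain Q where Q: "Q \<in> countable_partitions \<Omega> H"
    "\<And>\<alpha>. \<alpha> \<in> Q \<Longrightarrow> (\<exists>i. \<alpha> \<subseteq> A i) \<or> \<alpha> \<inter> (\<Union>i. A i) = {}"
    using countable_partition_of_sequence[OF algebra A(1,2)] by (elim bexE) metis
  show ?thesis
  proof (rule that[OF Q(1)])
    fix P \<delta> assume P: "P \<in> countable_partitions \<Omega> H" "refines \<Omega> P Q" and \<delta>: "choice_function \<Omega> \<delta>"
    have part: "\<Union>P = \<Omega>" "disjoint P" "{} \<notin> P" "countable P" "P \<subseteq> H"
      using P(1) unfolding countable_partitions_def partition_on_def by auto
    have cell: "(\<exists>i. \<alpha> \<subseteq> A i) \<or> \<alpha> \<inter> (\<Union>i. A i) = {}" if \<alpha>: "\<alpha> \<in> P" for \<alpha>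
    proof -
      obtain \<beta> where "\<beta> \<in> Q" "\<alpha> \<subseteq> \<beta>" using P(2) \<alpha> unfolding refines_def by blast
      then show ?thesis using Q(2)[of \<beta>] by blast
    qed
    have tag: "\<delta> \<alpha> \<in> \<alpha>" if "\<alpha> \<in> P" for \<alpha>
      using \<delta> that part(1,3) unfolding choice_function_def by blast
    define B where "B i = {\<alpha>\<in>P. \<alpha> \<subseteq> A i}" for i
    have disjB: "disjoint_family B"
      unfolding disjoint_family_on_def
    proof (intro ballI impI equals0I)
      fix i j \<alpha> assume "i \<noteq> j" "\<alpha> \<in> B i \<inter> B j"
      then have "\<delta> \<alpha> \<in> A i \<inter> A j" using tag unfolding B_def by blast
      moreover have "A i \<inter> A j = {}" using A(2) \<open>i \<noteq> j\<close> unfolding disjoint_family_on_def by simp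
      ultimately show False by simp
    qed
    have UnB: "\<Union>(B i) = A i" for i
    proof
      show "A i \<subseteq> \<Union>(B i)"
      proof
        fix w assume w: "w \<in> A i"
        then obtain \<alpha> where \<alpha>: "\<alpha> \<in> P" "w \<in> \<alpha>" using A_sub part(1) by blast
        then obtain j where j: "\<alpha> \<subseteq> A j" using cell[OF \<alpha>(1)] w by blast
        then have "j = i" using A(2) w \<alpha>(2) unfolding disjoint_family_on_def by blast
        then show "w \<in> \<Union>(B i)" using \<alpha> j unfolding B_def by blast
      qed
    qed (auto simp: B_def)
    have block: "has_sup_sum (\<lambda>\<alpha>. bp (g (\<delta> \<alpha>)) (\<mu> \<alpha>)) (B i) (bp (a i) (\<mu> (A i)))" for i
    proof (cases "A i = {}")
      case True
      then have "B i = {}" using part(3) unfolding B_def by auto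
      then show ?thesis using True has_sup_sum_empty measure_empty bilinear_rzero[OF bilinear] by simp
    next
      case False
      have "B i \<subseteq> P" unfolding B_def by blast
      then have "disjoint (B i)" using part(2) by (rule pairwise_subset[rotated])
      moreover have "countable (B i)" using part(4) unfolding B_def by simp
      moreover have "B i \<subseteq> H" using part(5) unfolding B_def by blast
      ultimately have "has_sup_sum (\<lambda>\<alpha>. bp (a i) (\<mu> \<alpha>)) (B i) (bp (a i) (\<mu> (A i)))"
        using product_measure_partition[of "B i" "a i"] a_pos[OF False] unfolding UnB by blast
      moreover have "g (\<delta> \<alpha>) = a i" if "\<alpha> \<in> B i" for \<alpha>
        using that tag A(3) unfolding B_def by blast
      ultimately show ?thesis by (subst has_sup_sum_cong) auto
    qed
    from has_sup_sum_UNION[OF disjB block lub]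
    have sum: "has_sup_sum (\<lambda>\<alpha>. bp (g (\<delta> \<alpha>)) (\<mu> \<alpha>)) (\<Union>i. B i) p" .
    show "has_sup_sum (\<lambda>\<alpha>. bp (g (\<delta> \<alpha>)) (\<mu> \<alpha>)) P p"
    proof (rule has_sup_sum_mono_neutral[OF _ _ sum])
      show "(\<Union>i. B i) \<subseteq> P" unfolding B_def by blast
      fix \<alpha> assume \<alpha>: "\<alpha> \<in> P - (\<Union>i. B i)"
      then have "\<alpha> \<inter> (\<Union>i. A i) = {}" using cell[of \<alpha>] unfolding B_def by blast
      then have "\<delta> \<alpha> \<in> \<Omega> - (\<Union>i. A i)" using \<alpha> tag part(1) by blast
      then show "bp (g (\<delta> \<alpha>)) (\<mu> \<alpha>) = 0" using A(4) bilinear_lzero[OF bilinear] by simp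
    qed
  qed
qed

text \<open>The term of \<open>f\<close> at a cell is that of \<open>g\<close> plus an error dominated by the product of \<open>u\<close> with the
  measure of the cell, and these dominating terms add up to \<open>bp u (\<mu> \<Omega>)\<close>. The errors have no fixed sign,
  so they are shifted by the dominating terms; the shifted series is nonnegative and bounded, and hence
  summable by Dedekind completeness.\<close>

lemma partition_sums_near_elementary_integral:
  assumes int: "elementary_has_integral bp \<Omega> H \<mu> g z" and N: "N \<in> H" "\<mu> N = 0"
    and near: "\<And>w. w \<in> \<Omega> - N \<Longrightarrow> \<bar>g w - f w\<bar> \<le> u" and u: "0 \<le> u"
  obtains Q where "Q \<in> countable_partitions \<Omega> H"
    "\<And>P \<delta>. P \<in> countable_partitions \<Omega> H \<Longrightarrow> refines \<Omega> P Q \<Longrightarrow> choice_function \<Omega> \<delta> \<Longrightarrow>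
       \<exists>s. unconditional_sum (\<lambda>\<alpha>. bp (f (\<delta> \<alpha>)) (\<mu> \<alpha>)) P s \<and> \<bar>s - z\<bar> \<le> bp u (\<mu> \<Omega>)"
proof -
  obtain p q where p: "elementary_pos_has_integral bp \<Omega> H \<mu> (\<lambda>w. sup (g w) 0) p"
    and q: "elementary_pos_has_integral bp \<Omega> H \<mu> (\<lambda>w. sup (- g w) 0) q" and z: "z = p - q"
    using int unfolding elementary_has_integral_def by blast
  obtain Q1 where Q1: "Q1 \<in> countable_partitions \<Omega> H"
    "\<And>P \<delta>. P \<in> countable_partitions \<Omega> H \<Longrightarrow> refines \<Omega> P Q1 \<Longrightarrow> choice_function \<Omega> \<delta> \<Longrightarrow>
       has_sup_sum (\<lambda>\<alpha>. bp (sup (g (\<delta> \<alpha>)) 0) (\<mu> \<alpha>)) P p"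
    using elementary_integral_eq_partition_sum[OF p] by blast
  obtain Q2 where Q2: "Q2 \<in> countable_partitions \<Omega> H"
    "\<And>P \<delta>. P \<in> countable_partitions \<Omega> H \<Longrightarrow> refines \<Omega> P Q2 \<Longrightarrow> choice_function \<Omega> \<delta> \<Longrightarrow>
       has_sup_sum (\<lambda>\<alpha>. bp (sup (- g (\<delta> \<alpha>)) 0) (\<mu> \<alpha>)) P q"
    using elementary_integral_eq_partition_sum[OF q] by blast
  let ?A = "\<lambda>n::nat. if n = 0 then N else {}"
  have seqN: "range ?A \<subseteq> H" "disjoint_family ?A"
    using N(1) by (auto simp: disjoint_family_on_def)
  have UnN: "(\<Union>n. ?A n) = N" by auto
  obtain Q3 where Q3: "Q3 \<in> countable_partitions \<Omega> H"
    "\<And>\<alpha>. \<alpha> \<in> Q3 \<Longrightarrow> (\<exists>i. \<alpha> \<subseteq> ?A i) \<or> \<alpha> \<inter> N = {}"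
    using countable_partition_of_sequence[OF algebra seqN] unfolding UnN by (elim bexE) metis
  obtain Q12 where Q12: "Q12 \<in> countable_partitions \<Omega> H" "refines \<Omega> Q12 Q1" "refines \<Omega> Q12 Q2"
    using countable_partitions_common_refinement[OF algebra Q1(1) Q2(1)] .
  obtain Q where Q: "Q \<in> countable_partitions \<Omega> H" "refines \<Omega> Q Q12" "refines \<Omega> Q Q3"
    using countable_partitions_common_refinement[OF algebra Q12(1) Q3(1)] .
  show ?thesis
  proof (rule that[OF Q(1)])
    fix P \<delta> assume P: "P \<in> countable_partitions \<Omega> H" "refines \<Omega> P Q" and \<delta>: "choice_function \<Omega> \<delta>"
    have ref: "refines \<Omega> P Q1" "refines \<Omega> P Q2" "refines \<Omega> P Q3"
      using P(2) Q(2,3) Q12(2,3) by (blast intro: refines_trans)+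
    have part: "\<Union>P = \<Omega>" "disjoint P" "{} \<notin> P" "countable P" "P \<subseteq> H"
      using P(1) unfolding countable_partitions_def partition_on_def by auto
    have \<mu>_pos: "0 \<le> \<mu> \<alpha>" if "\<alpha> \<in> P" for \<alpha> using that part(5) positive by blast
    let ?D = "bp u (\<mu> \<Omega>)"
    let ?err = "\<lambda>\<alpha>. bp (f (\<delta> \<alpha>) - g (\<delta> \<alpha>)) (\<mu> \<alpha>)"
    have err: "\<bar>?err \<alpha>\<bar> \<le> bp u (\<mu> \<alpha>)" if \<alpha>: "\<alpha> \<in> P" for \<alpha>
    proof -
      obtain \<beta> where "\<beta> \<in> Q3" "\<alpha> \<subseteq> \<beta>" using ref(3) \<alpha> unfolding refines_def by blast
      moreover have "?A i \<subseteq> N" for i by simp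
      ultimately consider "\<alpha> \<subseteq> N" | "\<alpha> \<inter> N = {}" using Q3(2)[of \<beta>] by blast
      then show ?thesis
      proof cases
        case 1
        then have "\<mu> \<alpha> = 0" using measure_subset_null N \<alpha> part(5) by blast
        then show ?thesis using bilinear_rzero[OF bilinear] by simp
      next
        case 2
        have "\<delta> \<alpha> \<in> \<alpha>" using \<delta> \<alpha> part(1,3) unfolding choice_function_def by blast
        then have "\<delta> \<alpha> \<in> \<Omega> - N" using 2 \<alpha> part(1) by blast
        then have "\<bar>f (\<delta> \<alpha>) - g (\<delta> \<alpha>)\<bar> \<le> u" using near by (simp add: abs_minus_commute)
        then show ?thesis using abs_product_le \<mu>_pos[OF \<alpha>] by blast
      qed
    qed
    have D: "has_sup_sum (\<lambda>\<alpha>. bp u (\<mu> \<alpha>)) P ?D"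
      using product_measure_partition[OF part(4,2,5) u] unfolding part(1) .
    have shifted: "0 \<le> ?err \<alpha> + bp u (\<mu> \<alpha>)" "?err \<alpha> + bp u (\<mu> \<alpha>) \<le> bp u (\<mu> \<alpha>) + bp u (\<mu> \<alpha>)"
      if "\<alpha> \<in> P" for \<alpha>
    proof -
      have "?err \<alpha> \<le> bp u (\<mu> \<alpha>)" "- ?err \<alpha> \<le> bp u (\<mu> \<alpha>)"
        using err[OF that] unfolding abs_le_iff_bounds by blast+
      then show "0 \<le> ?err \<alpha> + bp u (\<mu> \<alpha>)" "?err \<alpha> + bp u (\<mu> \<alpha>) \<le> bp u (\<mu> \<alpha>) + bp u (\<mu> \<alpha>)"
        using add_left_mono[of "- ?err \<alpha>" "bp u (\<mu> \<alpha>)" "?err \<alpha>"] by simp_all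
    qed
    have bound: "(\<Sum>\<alpha>\<in>F. ?err \<alpha> + bp u (\<mu> \<alpha>)) \<le> ?D + ?D" if F: "finite F" "F \<subseteq> P" for F
    proof -
      have "(\<Sum>\<alpha>\<in>F. ?err \<alpha> + bp u (\<mu> \<alpha>)) \<le> (\<Sum>\<alpha>\<in>F. bp u (\<mu> \<alpha>) + bp u (\<mu> \<alpha>))"
        using F(2) shifted(2) by (intro sum_mono) blast
      also have "\<dots> = (\<Sum>\<alpha>\<in>F. bp u (\<mu> \<alpha>)) + (\<Sum>\<alpha>\<in>F. bp u (\<mu> \<alpha>))" by (rule sum.distrib)
      also have "\<dots> \<le> ?D + ?D" using has_sup_sum_upper[OF D F] by (intro add_mono)
      finally show ?thesis .
    qed
    then obtain t where t: "has_sup_sum (\<lambda>\<alpha>. ?err \<alpha> + bp u (\<mu> \<alpha>)) P t"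
      by (rule has_sup_sum_exists_if_bounded)
    have t_bounds: "0 \<le> t" "t \<le> ?D + ?D"
      using has_sup_sum_upper[OF t, of "{}"] has_sup_sum_least[OF t bound] by auto
    have "unconditional_sum (\<lambda>\<alpha>. bp (sup (g (\<delta> \<alpha>)) 0) (\<mu> \<alpha>)) P p"
      using Q1(2)[OF P(1) ref(1) \<delta>] product_nonneg \<mu>_pos
      by (subst unconditional_sum_iff_has_sup_sum) auto
    moreover have "unconditional_sum (\<lambda>\<alpha>. bp (sup (- g (\<delta> \<alpha>)) 0) (\<mu> \<alpha>)) P q"
      using Q2(2)[OF P(1) ref(2) \<delta>] product_nonneg \<mu>_pos
      by (subst unconditional_sum_iff_has_sup_sum) auto
    moreover have "unconditional_sum (\<lambda>\<alpha>. bp u (\<mu> \<alpha>)) P ?D"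
      using D product_nonneg[OF u] \<mu>_pos by (subst unconditional_sum_iff_has_sup_sum) auto
    moreover have "unconditional_sum (\<lambda>\<alpha>. ?err \<alpha> + bp u (\<mu> \<alpha>)) P t"
      using t shifted(1) by (subst unconditional_sum_iff_has_sup_sum) auto
    ultimately have "unconditional_sum (\<lambda>\<alpha>. (bp (sup (g (\<delta> \<alpha>)) 0) (\<mu> \<alpha>) - bp (sup (- g (\<delta> \<alpha>)) 0) (\<mu> \<alpha>))
        - (bp u (\<mu> \<alpha>) - (?err \<alpha> + bp u (\<mu> \<alpha>)))) P ((p - q) - (?D - t))"
      by (intro unconditional_sum_diff)
    moreover have "(bp (sup (g (\<delta> \<alpha>)) 0) (\<mu> \<alpha>) - bp (sup (- g (\<delta> \<alpha>)) 0) (\<mu> \<alpha>))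
        - (bp u (\<mu> \<alpha>) - (?err \<alpha> + bp u (\<mu> \<alpha>))) = bp (f (\<delta> \<alpha>)) (\<mu> \<alpha>)" for \<alpha>
    proof -
      have "sup (g (\<delta> \<alpha>)) 0 - sup (- g (\<delta> \<alpha>)) 0 = g (\<delta> \<alpha>)"
        using prts[of "g (\<delta> \<alpha>)"] neg_sup_eq_inf[of "- g (\<delta> \<alpha>)" 0] unfolding pprt_def nprt_def by simp
      then have "bp (sup (g (\<delta> \<alpha>)) 0) (\<mu> \<alpha>) - bp (sup (- g (\<delta> \<alpha>)) 0) (\<mu> \<alpha>) = bp (g (\<delta> \<alpha>)) (\<mu> \<alpha>)"
        unfolding bilinear_lsub[OF bilinear, symmetric] by simp
      then show ?thesis by (simp add: bilinear_lsub[OF bilinear])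
    qed
    ultimately have "unconditional_sum (\<lambda>\<alpha>. bp (f (\<delta> \<alpha>)) (\<mu> \<alpha>)) P (z - (?D - t))" by (simp add: z)
    moreover have "\<bar>z - (?D - t) - z\<bar> \<le> ?D"
      unfolding abs_le_iff_bounds using t_bounds by (simp add: algebra_simps)
    ultimately show "\<exists>s. unconditional_sum (\<lambda>\<alpha>. bp (f (\<delta> \<alpha>)) (\<mu> \<alpha>)) P s \<and> \<bar>s - z\<bar> \<le> ?D" by blast
  qed
qed

text \<open>The integrals of the approximating functions approximate the same partition sums of \<open>f\<close>, which
  forces them to converge and identifies their limit.\<close>

lemma pavlakos_limit_is_S_star_integral:
  assumes approx: "pavlakos_approx bp \<Omega> H \<mu> f fs"
    and ints: "\<And>n. elementary_has_integral bp \<Omega> H \<mu> (fs n) (zs n)"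
  obtains z where "order_conv_seq zs z" "S_star_has_integral bp \<Omega> H \<mu> f z"
proof -
  let ?S = "\<lambda>P \<delta> s. unconditional_sum (\<lambda>\<alpha>. bp (f (\<delta> \<alpha>)) (\<mu> \<alpha>)) P s"
  obtain N u where N: "N \<in> H" "\<mu> N = 0" and u: "decseq u" "isGlb UNIV (range u) 0"
    and near: "\<And>w n. w \<in> \<Omega> - N \<Longrightarrow> \<bar>fs n w - f w\<bar> \<le> u n"
    using approx unfolding pavlakos_approx_def uniform_ae_order_conv_def by blast
  have u0: "0 \<le> u n" for n using u(2) unfolding isGlb_UNIV_iff by blast
  have \<mu>\<Omega>: "0 \<le> \<mu> \<Omega>" using positive by blast
  define v where "v n = bp (u n) (\<mu> \<Omega>)" for n
  have v0: "0 \<le> v n" for n unfolding v_def using u0 \<mu>\<Omega> by (rule product_nonneg)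
  have v_anti: "v n \<le> v m" if "m \<le> n" for m n
    unfolding v_def using u(1) that \<mu>\<Omega> by (intro product_left_mono) (auto simp: decseq_def)
  have v_glb: "isGlb UNIV (range v) 0"
    using product_decreasing_to_zero[OF u \<mu>\<Omega>] unfolding v_def .
  have "\<exists>Q\<in>countable_partitions \<Omega> H. \<forall>P\<in>countable_partitions \<Omega> H. refines \<Omega> P Q \<longrightarrow>
      (\<forall>\<delta>. choice_function \<Omega> \<delta> \<longrightarrow> (\<exists>s. ?S P \<delta> s \<and> \<bar>s - zs n\<bar> \<le> v n))" for n
    unfolding v_def
    by (rule partition_sums_near_elementary_integral[OF ints[of n] N near u0[of n]]) blast+
  then obtain Q where Q: "\<And>n. Q n \<in> countable_partitions \<Omega> H"
    "\<And>n P \<delta>. P \<in> countable_partitions \<Omega> H \<Longrightarrow> refines \<Omega> P (Q n) \<Longrightarrow> choice_function \<Omega> \<delta> \<Longrightarrow>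
       \<exists>s. ?S P \<delta> s \<and> \<bar>s - zs n\<bar> \<le> v n"
    by metis
  obtain \<delta>0 :: "'w set \<Rightarrow> 'w" where \<delta>0: "choice_function \<Omega> \<delta>0"
    by (rule choice_function_exists)
  have cauchy: "\<bar>zs m - zs n\<bar> \<le> v m + v n" for m n
  proof -
    obtain R where R: "R \<in> countable_partitions \<Omega> H" "refines \<Omega> R (Q m)" "refines \<Omega> R (Q n)"
      using countable_partitions_common_refinement[OF algebra Q(1) Q(1)] .
    obtain s s' where s: "?S R \<delta>0 s" "\<bar>s - zs m\<bar> \<le> v m" "?S R \<delta>0 s'" "\<bar>s' - zs n\<bar> \<le> v n"
      using Q(2)[OF R(1,2) \<delta>0] Q(2)[OF R(1,3) \<delta>0] by blast
    have "s' = s" using s(3,1) by (rule unconditional_sum_unique)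
    then show ?thesis
      using s by (intro abs_diff_le_add[of _ s]) (auto simp: abs_minus_commute)
  qed
  have below: "zs m - v m \<le> zs n + v n" for m n
  proof -
    have "zs m - zs n \<le> v m + v n" using cauchy[of m n] unfolding abs_le_iff_bounds by blast
    then show ?thesis by (simp add: algebra_simps)
  qed
  \<comment> \<open>Every lower end of the intervals \<open>[zs n - v n, zs n + v n]\<close> is below every upper end, so the
    infimum of the upper ends lies in all of them.\<close>
  define z where "z = (INF n. zs n + v n)"
  have "bdd_below (range (\<lambda>n. zs n + v n))" using below[of 0] by (intro bdd_belowI[of _ "zs 0 - v 0"]) auto
  then have z_upper: "z \<le> zs n + v n" for n unfolding z_def by (intro cINF_lower) auto
  have z_lower: "zs n - v n \<le> z" for n unfolding z_def using below by (intro cINF_greatest) auto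
  have z: "\<bar>zs n - z\<bar> \<le> v n" for n
    unfolding abs_le_iff_bounds using z_upper[of n] z_lower[of n] by (simp add: algebra_simps)
  have "order_conv_seq zs z"
  proof (rule order_convI[OF directed_index_nat _ v_glb])
    fix n show "\<exists>i0\<in>UNIV. \<forall>i\<in>UNIV. i0 \<le> i \<longrightarrow> \<bar>zs i - z\<bar> \<le> v n"
      using z v_anti by (blast intro: order_trans)
  qed (rule v_anti)
  moreover
  \<comment> \<open>One \<open>v j\<close> bounds the distance of the partition sums to \<open>zs j\<close>, the other that of \<open>zs j\<close> to \<open>z\<close>.\<close>
  define a where "a i j = v j + v j" for i j :: nat
  have "D_sequence a"
    unfolding D_sequence_def
  proof (intro conjI allI exI)
    fix i j
    show "\<bar>a i j\<bar> \<le> v 0 + v 0" using v0 v_anti by (simp add: a_def add_mono)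
    show "a i (Suc j) \<le> a i j" unfolding a_def using v_anti by (intro add_mono) auto
    have a0: "0 \<le> a i j" for j using v0 unfolding a_def by simp
    have a_le: "a i (max m n) \<le> v m + v n" for m n
      unfolding a_def using v_anti by (intro add_mono) auto
    have "x \<le> v m + v n" if "\<And>j. x \<le> a i j" for x m n
      using that a_le by (rule order_trans)
    then have "x \<le> 0" if "\<And>j. x \<le> a i j" for x
      using that by (intro le_zero_if_le_sums[OF v_glb v_glb]) blast
    then show "(INF j. a i j) = 0"
      using a0 by (intro cInf_eq_non_empty) auto
  qed
  moreover have "\<exists>P0\<in>countable_partitions \<Omega> H. \<forall>P\<in>countable_partitions \<Omega> H. refines \<Omega> P P0 \<longrightarrow>
      (\<forall>\<delta>. choice_function \<Omega> \<delta> \<longrightarrow> (\<exists>s. ?S P \<delta> s \<and> \<bar>s - z\<bar> \<le> (SUP i. a i (\<phi> i))))"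
    for \<phi> :: "nat \<Rightarrow> nat"
  proof (intro bexI[OF _ Q(1)[of "\<phi> 0"]] ballI impI allI)
    fix P \<delta> assume "P \<in> countable_partitions \<Omega> H" "refines \<Omega> P (Q (\<phi> 0))" "choice_function \<Omega> \<delta>"
    then obtain s where s: "?S P \<delta> s" "\<bar>s - zs (\<phi> 0)\<bar> \<le> v (\<phi> 0)" using Q(2) by blast
    have "\<bar>s - z\<bar> \<le> a 0 (\<phi> 0)" unfolding a_def using s(2) z by (rule abs_diff_le_add)
    also have "\<dots> \<le> (SUP i. a i (\<phi> i))"
    proof (rule cSUP_upper)
      have "a i (\<phi> i) \<le> v 0 + v 0" for i unfolding a_def using v_anti by (intro add_mono) auto
      then show "bdd_above (range (\<lambda>i. a i (\<phi> i)))" by (intro bdd_aboveI[of _ "v 0 + v 0"]) auto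
    qed simp
    finally show "\<exists>s. ?S P \<delta> s \<and> \<bar>s - z\<bar> \<le> (SUP i. a i (\<phi> i))" using s(1) by blast
  qed
  moreover have "\<exists>P1\<in>countable_partitions \<Omega> H. \<forall>P\<in>countable_partitions \<Omega> H. refines \<Omega> P P1 \<longrightarrow>
      (\<forall>\<delta>. choice_function \<Omega> \<delta> \<longrightarrow> (\<exists>s. ?S P \<delta> s))"
    using Q(2) by (intro bexI[OF _ Q(1)[of 0]]) metis
  ultimately show ?thesis
    by (intro that) (auto simp: S_star_has_integral_def)
qed

end

text \<open>The tagged partitions, directed by refinement of the partitions alone, index the net of partition
  sums. The \<open>S\<^sup>*\<close>-integral is a (D)-limit of this net, and weak \<open>\<sigma>\<close>-distributivity turns it into an
  order limit, which is unique.\<close>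

lemma S_star_has_integral_unique:
  fixes bp :: "'x::riesz_space \<Rightarrow> 'y::riesz_space \<Rightarrow> 'z::{riesz_space, conditionally_complete_lattice}"
    and \<Omega> :: "'w set"
  assumes wsd: "weakly_sigma_distributive TYPE('z)" and alg: "sigma_algebra \<Omega> H"
    and z: "S_star_has_integral bp \<Omega> H \<mu> f z" and z': "S_star_has_integral bp \<Omega> H \<mu> f z'"
  shows "z = z'"
proof -
  define I where "I = countable_partitions \<Omega> H \<times> {\<delta>. choice_function \<Omega> \<delta>}"
  define leI :: "'w set set \<times> ('w set \<Rightarrow> 'w) \<Rightarrow> 'w set set \<times> ('w set \<Rightarrow> 'w) \<Rightarrow> bool"
    where "leI = (\<lambda>i j. refines \<Omega> (fst j) (fst i))"
  define S where "S = (\<lambda>(P, \<delta>). THE s. unconditional_sum (\<lambda>\<alpha>. bp (f (\<delta> \<alpha>)) (\<mu> \<alpha>)) P s)"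
  have S: "S (P, \<delta>) = s" if "unconditional_sum (\<lambda>\<alpha>. bp (f (\<delta> \<alpha>)) (\<mu> \<alpha>)) P s" for P \<delta> s
    unfolding S_def using that by (auto intro: unconditional_sum_unique)
  obtain \<delta>0 :: "'w set \<Rightarrow> 'w" where \<delta>0: "choice_function \<Omega> \<delta>0" by (rule choice_function_exists)
  have I: "directed_index I leI"
    unfolding directed_index_def
  proof (intro conjI ballI impI)
    show "I \<noteq> {}" using z \<delta>0 unfolding S_star_has_integral_def I_def by blast
    show "leI i i" if "i \<in> I" for i
      using that unfolding leI_def I_def countable_partitions_def by (auto intro: refines_refl)
    show "leI i k" if "leI i j" "leI j k" for i j k
      using that unfolding leI_def by (blast intro: refines_trans)
    show "\<exists>k\<in>I. leI i k \<and> leI j k" if "i \<in> I" "j \<in> I" for i j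
    proof -
      have ij: "fst i \<in> countable_partitions \<Omega> H" "fst j \<in> countable_partitions \<Omega> H"
        using that unfolding I_def by auto
      obtain R where "R \<in> countable_partitions \<Omega> H" "refines \<Omega> R (fst i)" "refines \<Omega> R (fst j)"
        using countable_partitions_common_refinement[OF alg ij] .
      then show ?thesis using \<delta>0 unfolding I_def leI_def by (intro bexI[of _ "(R, \<delta>0)"]) auto
    qed
  qed
  have conv: "order_conv I leI S y" if y: "S_star_has_integral bp \<Omega> H \<mu> f y" for y
  proof (rule D_conv_imp_order_conv[OF wsd])
    obtain a where a: "D_sequence a" and near: "\<And>\<phi>::nat \<Rightarrow> nat. \<exists>P0\<in>countable_partitions \<Omega> H.
        \<forall>P\<in>countable_partitions \<Omega> H. refines \<Omega> P P0 \<longrightarrow> (\<forall>\<delta>. choice_function \<Omega> \<delta> \<longrightarrow>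
          (\<exists>s. unconditional_sum (\<lambda>\<alpha>. bp (f (\<delta> \<alpha>)) (\<mu> \<alpha>)) P s \<and> \<bar>s - y\<bar> \<le> (SUP i. a i (\<phi> i))))"
      using y unfolding S_star_has_integral_def by blast
    show "D_conv I leI S y"
      unfolding D_conv_def
    proof (intro exI[of _ a] conjI allI a)
      fix \<phi> :: "nat \<Rightarrow> nat"
      obtain P0 where P0: "P0 \<in> countable_partitions \<Omega> H"
        "\<And>P \<delta>. P \<in> countable_partitions \<Omega> H \<Longrightarrow> refines \<Omega> P P0 \<Longrightarrow> choice_function \<Omega> \<delta> \<Longrightarrow>
          \<exists>s. unconditional_sum (\<lambda>\<alpha>. bp (f (\<delta> \<alpha>)) (\<mu> \<alpha>)) P s \<and> \<bar>s - y\<bar> \<le> (SUP i. a i (\<phi> i))"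
        using near[of \<phi>] by blast
      have "\<bar>S i - y\<bar> \<le> (SUP k. a k (\<phi> k))" if "i \<in> I" "leI (P0, \<delta>0) i" for i
        using that P0(2)[of "fst i" "snd i"] S[of "snd i" "fst i"] unfolding I_def leI_def by auto
      moreover have "(P0, \<delta>0) \<in> I" using P0(1) \<delta>0 unfolding I_def by blast
      ultimately show "\<exists>i0\<in>I. \<forall>i\<in>I. leI i0 i \<longrightarrow> \<bar>S i - y\<bar> \<le> (SUP k. a k (\<phi> k))" by blast
    qed
  qed
  show ?thesis using order_conv_unique[OF I conv[OF z] conv[OF z']] .
qed

theorem corollary5p3p1:
  fixes bp :: "'x::riesz_space \<Rightarrow> 'y::riesz_space \<Rightarrow> 'z::{riesz_space, conditionally_complete_lattice}"
    and \<Omega> :: "'w set" and H :: "'w set set" and \<mu> :: "'w set \<Rightarrow> 'y"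
    and \<Gamma> :: "'w set \<Rightarrow> 'g set" and le :: "'w set \<Rightarrow> 'g \<Rightarrow> 'g \<Rightarrow> bool"
    and Ix :: "'w set \<Rightarrow> 'g \<Rightarrow> 'i set"
    and \<sigma> :: "'w set \<Rightarrow> 'g \<Rightarrow> 'i \<Rightarrow> 'w set" and \<tau> :: "'w set \<Rightarrow> 'g \<Rightarrow> 'i \<Rightarrow> 'w"
    and f :: "'w \<Rightarrow> 'x"
  assumes "riesz_product bp"
    and "weakly_sigma_distributive TYPE('z)"
    and "first_countable_order TYPE('x)"
    and "sigma_algebra \<Omega> H"
    and "\<forall>A\<in>H. 0 \<le> \<mu> A"
    and "sigma_additive H \<mu>"
    and "tagged_nets \<Omega> H \<Gamma> le Ix \<sigma> \<tau>"
    and "regular_integrator \<Omega> H \<Gamma> le Ix \<sigma> \<tau> \<mu>"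
    and "pavlakos_integrable bp \<Omega> H \<mu> f"
  shows "S_star_integrable bp \<Omega> H \<mu> f \<and>
    pavlakos_integral bp \<Omega> H \<mu> f = S_star_integral bp \<Omega> H \<mu> f"
proof -
  interpret positive_product_measure bp \<Omega> H \<mu>
    by (rule positive_product_measure.intro) (fact assms)+
  have S_star_of_pavlakos: "S_star_has_integral bp \<Omega> H \<mu> f z"
    if "pavlakos_has_integral bp \<Omega> H \<mu> f z" for z
  proof -
    obtain fs zs where approx: "pavlakos_approx bp \<Omega> H \<mu> f fs"
      and ints: "\<And>n. elementary_has_integral bp \<Omega> H \<mu> (fs n) (zs n)" and lim: "order_conv_seq zs z"
      using \<open>pavlakos_has_integral bp \<Omega> H \<mu> f z\<close> unfolding pavlakos_has_integral_def by blast
    obtain z' where z': "order_conv_seq zs z'" "S_star_has_integral bp \<Omega> H \<mu> f z'"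
      using pavlakos_limit_is_S_star_integral[OF approx ints] .
    have "z' = z" using z'(1) lim by (rule order_conv_unique[OF directed_index_nat])
    then show ?thesis using z'(2) by simp
  qed
  obtain fs where approx: "pavlakos_approx bp \<Omega> H \<mu> f fs" and meas: "order_measurable \<Omega> H \<mu> f"
    using assms(9) unfolding pavlakos_integrable_def by blast
  obtain zs where ints: "\<And>n. elementary_has_integral bp \<Omega> H \<mu> (fs n) (zs n)"
    using approx unfolding pavlakos_approx_def elementary_integrable_def by metis
  obtain z where "order_conv_seq zs z" and S: "S_star_has_integral bp \<Omega> H \<mu> f z"
    using pavlakos_limit_is_S_star_integral[OF approx ints] .
  then have P: "pavlakos_has_integral bp \<Omega> H \<mu> f z"
    using meas approx ints unfolding pavlakos_has_integral_def by blast
  have unique: "y = z" if "S_star_has_integral bp \<Omega> H \<mu> f y" for y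
    using S_star_has_integral_unique[OF assms(2,4) that S] .
  have "pavlakos_integral bp \<Omega> H \<mu> f = z"
    unfolding pavlakos_integral_def using P unique S_star_of_pavlakos by blast
  moreover have "S_star_integral bp \<Omega> H \<mu> f = z"
    unfolding S_star_integral_def using S unique by blast
  ultimately show ?thesis using S unfolding S_star_integrable_def by (intro conjI exI) simp_all
qed

end
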